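(* Let $p\geq 2$ be an integer. For any real numbers $\alpha,\beta$ with $0\leq\alpha\leq\beta\leq p-1$, \[\dim_H B(\alpha,\beta)=\sup_{\alpha\leq t\leq\beta}h(t),\] where $B(\alpha,\beta)=\{x\in[0,1]\colon \underline{M}(x)=\alpha,\ \overline{M}(x)=\beta\}$.
   Context: Let $A=\{0,1,\ldots,p-1\}$. Each $x\in[0,1]$ is written in its $p$-adic expansion $x=\sum_{n\geq1}x_np^{-n}=0.x_1x_2x_3\ldots$ with $x_n\in A$ (the paper uses non-terminating expansions). Let $S_n(x)=\sum_{i=1}^n x_i$ and let $T$ be the shift $T(0.x_1x_2x_3\ldots)=0.x_2x_3\ldots$. The lower and upper moving digit means are \[\underline{M}(x)=\lim_{n\to\infty}\liminf_{m\to\infty}\frac{S_n(T^mx)}{n},\qquad \overline{M}(x)=\lim_{n\to\infty}\limsup_{m\to\infty}\frac{S_n(T^mx)}{n}\] (these limits in $n$ always exist). For $0\leq\alpha\leq p-1$, $n\geq1$, $\delta>0$, let $h(\alpha,n,\delta)$ be the number of words $x_1\cdots x_n\in A^n$ with $n(\alpha-\delta)<\sum_{i=1}^n x_i<n(\alpha+\delta)$, and define the $p$-adic entropy function \[h(\alpha)=\lim_{\delta\to0}\limsup_{n\to\infty}\frac{\log h(\alpha,n,\delta)}{n\log p}.\] $\dim_H$ denotes Hausdorff dimension. *)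

theory Defs
  imports "HOL-Analysis.Analysis"
begin

(* Contribution diam(U)^s of one covering set, with the usual conventions that the empty set
   contributes 0 and that 0^0 = 1 (whereas 0 powr 0 = 0). *)
definition hausdorff_gauge :: "real \<Rightarrow> 'a::metric_space set \<Rightarrow> real" where
  "hausdorff_gauge s U = (if U = {} then 0 else if s = 0 then 1 else diameter U powr s)"

(* Boundedness is required explicitly because diameter is unspecified on unbounded sets. *)
definition hausdorff_premeasure :: "real \<Rightarrow> real \<Rightarrow> 'a::metric_space set \<Rightarrow> ennreal" where
  "hausdorff_premeasure s \<delta> E =
     (INF U \<in> {U :: nat \<Rightarrow> 'a set. E \<subseteq> (\<Union>i. U i) \<and> (\<forall>i. bounded (U i) \<and> diameter (U i) \<le> \<delta>)}.
        \<Sum>i. ennreal (hausdorff_gauge s (U i)))"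

definition hausdorff_measure :: "real \<Rightarrow> 'a::metric_space set \<Rightarrow> ennreal" where
  "hausdorff_measure s E = (SUP \<delta> \<in> {0<..}. hausdorff_premeasure s \<delta> E)"

definition hausdorff_dim :: "'a::metric_space set \<Rightarrow> ereal" where
  "hausdorff_dim E = (INF s \<in> {s :: real. 0 \<le> s \<and> hausdorff_measure s E = 0}. ereal s)"

(* The non-terminating p-adic expansion of x in [0,1]; digits p x n is the digit x_(n+1).
   The point 0 has only the expansion 0.000..., so it is exempt from the condition of having
   infinitely many nonzero digits. *)
definition is_expansion :: "nat \<Rightarrow> real \<Rightarrow> (nat \<Rightarrow> nat) \<Rightarrow> bool" where
  "is_expansion p x d \<longleftrightarrow>
     (\<forall>n. d n < p) \<and> (\<lambda>n. real (d n) / real p ^ Suc n) sums x \<and>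
     (x \<noteq> 0 \<longrightarrow> infinite {n. d n \<noteq> 0})"

definition digits :: "nat \<Rightarrow> real \<Rightarrow> nat \<Rightarrow> nat" where
  "digits p x = (THE d. is_expansion p x d)"

definition digit_sum :: "nat \<Rightarrow> nat \<Rightarrow> real \<Rightarrow> nat" where
  "digit_sum p n x = (\<Sum>i<n. digits p x i)"

definition digit_shift :: "nat \<Rightarrow> real \<Rightarrow> real" where
  "digit_shift p x = (\<Sum>n. real (digits p x (Suc n)) / real p ^ Suc n)"

definition lower_moving_mean :: "nat \<Rightarrow> real \<Rightarrow> ereal" where
  "lower_moving_mean p x =
     lim (\<lambda>n. liminf (\<lambda>m. ereal (real (digit_sum p n ((digit_shift p ^^ m) x)) / real n)))"

definition upper_moving_mean :: "nat \<Rightarrow> real \<Rightarrow> ereal" where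
  "upper_moving_mean p x =
     lim (\<lambda>n. limsup (\<lambda>m. ereal (real (digit_sum p n ((digit_shift p ^^ m) x)) / real n)))"

definition word_count :: "nat \<Rightarrow> real \<Rightarrow> nat \<Rightarrow> real \<Rightarrow> nat" where
  "word_count p \<alpha> n \<delta> =
     card {w :: nat list. length w = n \<and> set w \<subseteq> {0..<p} \<and>
             real n * (\<alpha> - \<delta>) < real (sum_list w) \<and> real (sum_list w) < real n * (\<alpha> + \<delta>)}"

(* For 0 <= \<alpha> <= p - 1 and fixed \<delta> > 0 the count is positive for all large n, so the value
   ln 0 = 0 does not influence the limit superior. *)
definition entropy_fun :: "nat \<Rightarrow> real \<Rightarrow> ereal" where
  "entropy_fun p \<alpha> =
     Lim (at_right 0)
       (\<lambda>\<delta>. limsup (\<lambda>n. ereal (ln (real (word_count p \<alpha> n \<delta>)) / (real n * ln (real p)))))"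

definition moving_mean_level_set :: "nat \<Rightarrow> real \<Rightarrow> real \<Rightarrow> real set" where
  "moving_mean_level_set p \<alpha> \<beta> =
     {x \<in> {0..1}. lower_moving_mean p x = ereal \<alpha> \<and> upper_moving_mean p x = ereal \<beta>}"

end

theory Submission
  imports Defs
begin

text \<open>
  Upper bound: if \<open>s > h(t)\<close> for all \<open>t \<in> [\<alpha>, \<beta>]\<close>, compactness of \<open>[\<alpha>, \<beta>]\<close> gives \<open>e > 0\<close> such that for
  large \<open>n\<close> fewer than \<open>p^(ns)\<close> words of length \<open>n\<close> have mean in \<open>(\<alpha> - e, \<beta> + e)\<close>. For a point of the
  level set all late windows of some length \<open>n\<close> are such words, so cylinders cover efficiently.

  Lower bound: fix \<open>t \<in> [\<alpha>, \<beta>]\<close> with \<open>0 < t < p - 1\<close> (at the end points the entropy vanishes) and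
  concatenate blocks, each consisting of a freely chosen word with mean close to \<open>t\<close> and a short
  correction that keeps the running digit sum within bounded distance of a target sum. The target
  has slope \<open>t\<close> except on a sparse set of ever longer runs, where it alternately has slope \<open>\<alpha>\<close> and
  \<open>\<beta>\<close>. Bounded discrepancy forces the moving means to be exactly \<open>\<alpha>\<close> and \<open>\<beta>\<close>, while corrections and
  runs cost arbitrarily little of the dimension contributed by the free words. Since every free word
  ends in \<open>0\<close>, no carries occur and the free choices depend Hoelder continuously on the point.
\<close>

section \<open>Hausdorff measure and dimension\<close>

lemma hausdorff_gauge_nonneg: "0 \<le> hausdorff_gauge s U"
  by (simp add: hausdorff_gauge_def)

lemma hausdorff_premeasure_le_suminf:
  assumes "E \<subseteq> (\<Union>i. U i)" "\<And>i. bounded (U i)" "\<And>i. diameter (U i) \<le> \<delta>"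
  shows "hausdorff_premeasure s \<delta> E \<le> (\<Sum>i. ennreal (hausdorff_gauge s (U i)))"
  unfolding hausdorff_premeasure_def using assms by (intro INF_lower) auto

text \<open>A finite cover becomes a sequence by enumerating it and padding with empty sets, which
  cost nothing since \<open>hausdorff_gauge\<close> gives them 0 even for
  \<open>s = 0\<close>.\<close>

lemma hausdorff_premeasure_le_sum:
  assumes "finite I" "E \<subseteq> (\<Union>i\<in>I. V i)" "\<And>i. i \<in> I \<Longrightarrow> bounded (V i)"
    "\<And>i. i \<in> I \<Longrightarrow> diameter (V i) \<le> \<delta>" "0 \<le> \<delta>"
  shows "hausdorff_premeasure s \<delta> E \<le> ennreal (\<Sum>i\<in>I. hausdorff_gauge s (V i))"
proof -
  obtain h where h: "bij_betw h {0..<card I} I"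
    using ex_bij_betw_nat_finite[OF assms(1)] by blast
  define U where "U = (\<lambda>i. if i < card I then V (h i) else {})"
  have hI: "h i \<in> I" if "i < card I" for i
    using h that by (auto simp: bij_betw_def)
  have "E \<subseteq> (\<Union>i. U i)"
  proof
    fix x assume "x \<in> E"
    then obtain j where "j \<in> I" "x \<in> V j" using assms(2) by auto
    moreover then obtain i where "i < card I" "h i = j"
      by (metis h atLeast0LessThan bij_betw_def imageE lessThan_iff)
    ultimately show "x \<in> (\<Union>i. U i)" by (auto simp: U_def)
  qed
  then have "hausdorff_premeasure s \<delta> E \<le> (\<Sum>i. ennreal (hausdorff_gauge s (U i)))"
    using assms hI by (intro hausdorff_premeasure_le_suminf) (auto simp: U_def)
  also have "\<dots> = (\<Sum>i\<in>{0..<card I}. ennreal (hausdorff_gauge s (U i)))"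
    by (intro suminf_finite) (auto simp: U_def hausdorff_gauge_def)
  also have "\<dots> = (\<Sum>i\<in>{0..<card I}. ennreal (hausdorff_gauge s (V (h i))))"
    by (intro sum.cong) (auto simp: U_def)
  also have "\<dots> = (\<Sum>i\<in>I. ennreal (hausdorff_gauge s (V i)))"
    by (rule sum.reindex_bij_betw[OF h])
  also have "\<dots> = ennreal (\<Sum>i\<in>I. hausdorff_gauge s (V i))"
    by (simp add: hausdorff_gauge_nonneg)
  finally show ?thesis .
qed

lemma hausdorff_premeasure_UN_le:
  fixes E :: "nat \<Rightarrow> 'a::metric_space set"
  shows "hausdorff_premeasure s \<delta> (\<Union>i. E i) \<le> (\<Sum>i. hausdorff_premeasure s \<delta> (E i))"
proof (rule ennreal_le_epsilon)
  fix e :: real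
  assume fin: "(\<Sum>i. hausdorff_premeasure s \<delta> (E i)) < top" and e: "0 < e"
  have "\<exists>U. E i \<subseteq> (\<Union>j. U j) \<and> (\<forall>j. bounded (U j) \<and> diameter (U j) \<le> \<delta>) \<and>
      (\<Sum>j. ennreal (hausdorff_gauge s (U j))) \<le> hausdorff_premeasure s \<delta> (E i) + ennreal (e * (1/2) ^ Suc i)"
    for i
  proof -
    \<comment> \<open>In \<open>ennreal\<close>, adding a positive error gives a strictly larger
      value only at finite values; then some cover stays below the sum. The errors halve with
      \<open>i\<close> and add up to \<open>e\<close>.\<close>
    have "hausdorff_premeasure s \<delta> (E i) < top"
    proof (rule ccontr)
      assume "\<not> ?thesis"
      then have "hausdorff_premeasure s \<delta> (E i) = top" using less_top by blast
      then have "top \<le> (\<Sum>i. hausdorff_premeasure s \<delta> (E i))"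
        using sum_le_suminf[of "\<lambda>i. hausdorff_premeasure s \<delta> (E i)" "{i}"] by simp
      then show False using fin by simp
    qed
    then have "hausdorff_premeasure s \<delta> (E i) < hausdorff_premeasure s \<delta> (E i) + ennreal (e * (1/2) ^ Suc i)"
      using e ennreal_add_left_cancel_less[of "hausdorff_premeasure s \<delta> (E i)" 0 "ennreal (e * (1/2) ^ Suc i)"]
      by (simp add: less_top)
    then have "(INF U \<in> {U :: nat \<Rightarrow> 'a set. E i \<subseteq> (\<Union>j. U j) \<and> (\<forall>j. bounded (U j) \<and> diameter (U j) \<le> \<delta>)}.
        \<Sum>j. ennreal (hausdorff_gauge s (U j))) < hausdorff_premeasure s \<delta> (E i) + ennreal (e * (1/2) ^ Suc i)"
      by (simp add: hausdorff_premeasure_def)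
    then show ?thesis unfolding INF_less_iff by (auto intro: less_imp_le)
  qed
  then obtain U where U: "\<And>i. E i \<subseteq> (\<Union>j. U i j)" "\<And>i j. bounded (U i j)" "\<And>i j. diameter (U i j) \<le> \<delta>"
    "\<And>i. (\<Sum>j. ennreal (hausdorff_gauge s (U i j))) \<le>
      hausdorff_premeasure s \<delta> (E i) + ennreal (e * (1/2) ^ Suc i)"
    by metis
  define V where "V = (\<lambda>n. case prod_decode n of (i, j) \<Rightarrow> U i j)"
  have "(\<Union>i. E i) \<subseteq> (\<Union>n. V n)"
  proof
    fix x assume "x \<in> (\<Union>i. E i)"
    then obtain i j where "x \<in> U i j" using U(1) by blast
    then have "x \<in> V (prod_encode (i, j))" by (simp add: V_def)
    then show "x \<in> (\<Union>n. V n)" by blast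
  qed
  then have "hausdorff_premeasure s \<delta> (\<Union>i. E i) \<le> (\<Sum>n. ennreal (hausdorff_gauge s (V n)))"
    using U by (intro hausdorff_premeasure_le_suminf) (auto simp: V_def split: prod.split)
  also have "\<dots> = (\<Sum>n. (\<lambda>(i, j). ennreal (hausdorff_gauge s (U i j))) (prod_decode n))"
    by (intro suminf_cong) (simp add: V_def split: prod.split)
  also have "\<dots> = (\<Sum>i j. ennreal (hausdorff_gauge s (U i j)))"
    by (subst suminf_ennreal_2dimen[where g="\<lambda>i. (\<Sum>j. ennreal (hausdorff_gauge s (U i j)))"])
      (auto simp: comp_def)
  also have "\<dots> \<le> (\<Sum>i. hausdorff_premeasure s \<delta> (E i) + ennreal (e * (1/2) ^ Suc i))"
    by (intro suminf_le U) auto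
  also have "\<dots> = (\<Sum>i. hausdorff_premeasure s \<delta> (E i)) + (\<Sum>i. ennreal (e * (1/2) ^ Suc i))"
    by (rule suminf_add[symmetric]) auto
  also have "(\<Sum>i. ennreal (e * (1/2) ^ Suc i)) = ennreal e"
    using sums_mult[OF power_half_series, of e] e
    by (subst suminf_ennreal2) (auto simp: sums_iff)
  finally show "hausdorff_premeasure s \<delta> (\<Union>i. E i) \<le> (\<Sum>i. hausdorff_premeasure s \<delta> (E i)) + ennreal e" .
qed

lemma hausdorff_measure_eq_0_iff:
  "hausdorff_measure s E = 0 \<longleftrightarrow> (\<forall>\<delta>>0. hausdorff_premeasure s \<delta> E = 0)"
proof
  assume "hausdorff_measure s E = 0"
  then have "hausdorff_premeasure s \<delta> E \<le> 0" if "\<delta> > 0" for \<delta>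
    unfolding hausdorff_measure_def using that by (metis SUP_upper greaterThan_iff)
  then show "\<forall>\<delta>>0. hausdorff_premeasure s \<delta> E = 0" by simp
next
  assume "\<forall>\<delta>>0. hausdorff_premeasure s \<delta> E = 0"
  then have "hausdorff_measure s E \<le> 0"
    unfolding hausdorff_measure_def by (intro SUP_least) auto
  then show "hausdorff_measure s E = 0" by simp
qed

lemma hausdorff_measure_UN_null:
  fixes E :: "nat \<Rightarrow> 'a::metric_space set"
  assumes "\<And>i. hausdorff_measure s (E i) = 0"
  shows "hausdorff_measure s (\<Union>i. E i) = 0"
  unfolding hausdorff_measure_eq_0_iff
proof (intro allI impI)
  fix \<delta> :: real assume "0 < \<delta>"
  then have "(\<Sum>i. hausdorff_premeasure s \<delta> (E i)) = 0"
    using assms by (simp add: hausdorff_measure_eq_0_iff)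
  then show "hausdorff_premeasure s \<delta> (\<Union>i. E i) = 0"
    using hausdorff_premeasure_UN_le[of s \<delta> E] by simp
qed

lemma hausdorff_premeasure_mono: "E \<subseteq> F \<Longrightarrow> hausdorff_premeasure s \<delta> E \<le> hausdorff_premeasure s \<delta> F"
  unfolding hausdorff_premeasure_def by (intro INF_superset_mono) auto

lemma hausdorff_measure_null_subset:
  "E \<subseteq> F \<Longrightarrow> hausdorff_measure s F = 0 \<Longrightarrow> hausdorff_measure s E = 0"
  unfolding hausdorff_measure_eq_0_iff using hausdorff_premeasure_mono[of E F] by (metis le_zero_eq)

lemma hausdorff_dim_nonneg: "0 \<le> hausdorff_dim E"
  unfolding hausdorff_dim_def by (intro INF_greatest) auto

lemma hausdorff_dim_le:
  "0 \<le> s \<Longrightarrow> hausdorff_measure s E = 0 \<Longrightarrow> hausdorff_dim E \<le> ereal s"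
  unfolding hausdorff_dim_def by (intro INF_lower) auto

lemma le_hausdorff_dimI:
  "(\<And>s. 0 \<le> s \<Longrightarrow> ereal s < a \<Longrightarrow> hausdorff_measure s E \<noteq> 0) \<Longrightarrow> a \<le> hausdorff_dim E"
  unfolding hausdorff_dim_def by (intro INF_greatest) (auto simp: not_le[symmetric])

text \<open>The \<open>V i\<close> need not be measurable, so each is enclosed in an interval of
  radius \<open>r i\<close> around one of its points, whence the factor 2; then Lebesgue measure is
  countably subadditive.\<close>

lemma unit_interval_cover_ge:
  assumes "{0..<1::real} \<subseteq> (\<Union>i. V i)"
    and "\<And>i y y'. y \<in> V i \<Longrightarrow> y' \<in> V i \<Longrightarrow> \<bar>y - y'\<bar> \<le> r i"
    and "\<And>i. 0 \<le> r i"
  shows "1 \<le> (\<Sum>i. 2 * ennreal (r i))"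
proof -
  define c where "c = (\<lambda>i. SOME y. y \<in> V i)"
  define K where "K = (\<lambda>i. {c i - r i..c i + r i})"
  have K: "V i \<subseteq> K i" for i
  proof
    fix y assume y: "y \<in> V i"
    then have "c i \<in> V i" unfolding c_def by (rule someI)
    then have "\<bar>y - c i\<bar> \<le> r i" using y assms(2) by blast
    then show "y \<in> K i" by (auto simp: K_def abs_le_iff)
  qed
  have "1 = emeasure lborel {0..<1::real}" by simp
  also have "\<dots> \<le> emeasure lborel (\<Union>i. K i)"
  proof (rule emeasure_mono)
    show "{0..<1} \<subseteq> (\<Union>i. K i)" using assms(1) K by blast
  qed (auto simp: K_def)
  also have "\<dots> \<le> (\<Sum>i. emeasure lborel (K i))"
    by (intro emeasure_subadditive_countably) (auto simp: K_def)
  also have "\<dots> = (\<Sum>i. 2 * ennreal (r i))"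
    using assms(3) by (intro suminf_cong) (simp add: K_def flip: ennreal_numeral ennreal_mult)
  finally show ?thesis .
qed

text \<open>A map from the unit interval into \<open>E\<close> with Hoelder continuous inverse replaces the mass
  distribution principle.\<close>

lemma hausdorff_measure_neq_0I:
  fixes g :: "real \<Rightarrow> 'a::metric_space"
  assumes gE: "\<And>y. y \<in> {0..<1} \<Longrightarrow> g y \<in> E" and "0 < C" "0 \<le> s"
    and holder: "\<And>y y'. y \<in> {0..<1} \<Longrightarrow> y' \<in> {0..<1} \<Longrightarrow> \<bar>y - y'\<bar> \<le> C * dist (g y) (g y') powr s"
  shows "hausdorff_measure s E \<noteq> 0"
proof -
  have "ennreal (1 / (2 * C)) \<le> hausdorff_premeasure s 1 E"
    unfolding hausdorff_premeasure_def
  proof (rule INF_greatest, clarify)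
    fix U :: "nat \<Rightarrow> 'a set"
    assume cover: "E \<subseteq> (\<Union>i. U i)" and U: "\<forall>i. bounded (U i) \<and> diameter (U i) \<le> 1"
    define V where "V = (\<lambda>i. {y \<in> {0..<1}. g y \<in> U i})"
    have "1 \<le> (\<Sum>i. 2 * ennreal (C * hausdorff_gauge s (U i)))"
    proof (rule unit_interval_cover_ge)
      show "{0..<1} \<subseteq> (\<Union>i. V i)" using gE cover by (force simp: V_def)
      show "0 \<le> C * hausdorff_gauge s (U i)" for i
        using \<open>0 < C\<close> by (simp add: hausdorff_gauge_nonneg)
      fix i y y' assume y: "y \<in> V i" "y' \<in> V i"
      then have "dist (g y) (g y') \<le> diameter (U i)"
        using U by (intro diameter_bounded_bound) (auto simp: V_def)
      then have "dist (g y) (g y') powr s \<le> diameter (U i) powr s"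
        using \<open>0 \<le> s\<close> by (intro powr_mono2) auto
      \<comment> \<open>Equality for \<open>s > 0\<close>. For \<open>s = 0\<close> the left side is
        0 or 1, as \<open>0 powr 0 = 0\<close>, while the gauge of a nonempty set is 1.\<close>
      also have "\<dots> \<le> hausdorff_gauge s (U i)"
        using y by (auto simp: hausdorff_gauge_def V_def)
      finally have "C * dist (g y) (g y') powr s \<le> C * hausdorff_gauge s (U i)"
        using \<open>0 < C\<close> by simp
      then show "\<bar>y - y'\<bar> \<le> C * hausdorff_gauge s (U i)"
        using holder[of y y'] y by (auto simp: V_def)
    qed
    also have "\<dots> = (\<Sum>i. ennreal (2 * C) * ennreal (hausdorff_gauge s (U i)))"
      using \<open>0 < C\<close>
      by (intro suminf_cong) (simp add: hausdorff_gauge_nonneg mult.assoc flip: ennreal_mult ennreal_numeral)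
    also have "\<dots> = ennreal (2 * C) * (\<Sum>i. ennreal (hausdorff_gauge s (U i)))"
      by simp
    finally have "ennreal (1 / (2 * C)) * 1 \<le>
        ennreal (1 / (2 * C)) * (ennreal (2 * C) * (\<Sum>i. ennreal (hausdorff_gauge s (U i))))"
      by (rule mult_left_mono) simp
    also have "\<dots> = (\<Sum>i. ennreal (hausdorff_gauge s (U i)))"
      using \<open>0 < C\<close> by (simp flip: mult.assoc ennreal_mult)
    finally show "ennreal (1 / (2 * C)) \<le> (\<Sum>i. ennreal (hausdorff_gauge s (U i)))" by simp
  qed
  then show ?thesis
    using \<open>0 < C\<close> by (auto simp: hausdorff_measure_eq_0_iff intro!: exI[of _ 1])
qed

section \<open>Expansions\<close>

text \<open>The first \<open>n\<close> digits read as an integer in base \<open>p\<close>. It is the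
  numerator of the left end of the cylinder of order \<open>n\<close>, so comparing reals reduces to
  comparing integers.\<close>

fun prefix_num :: "nat \<Rightarrow> (nat \<Rightarrow> nat) \<Rightarrow> nat \<Rightarrow> nat" where
  "prefix_num p d 0 = 0"
| "prefix_num p d (Suc n) = p * prefix_num p d n + d n"

lemma sum_digits_eq_prefix_num:
  assumes "p > 0"
  shows "(\<Sum>i<n. real (d i) / real p ^ Suc i) = real (prefix_num p d n) / real p ^ n"
  using assms by (induction n) (auto simp: field_simps)

lemma prefix_num_cong: "(\<And>i. i < n \<Longrightarrow> d i = e i) \<Longrightarrow> prefix_num p d n = prefix_num p e n"
  by (induction n) auto

lemma digits_summable:
  assumes "p \<ge> 2" "\<And>n. d n < p"
  shows "summable (\<lambda>n. real (d n) / real p ^ Suc n)"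
proof (rule summable_comparison_test')
  show "summable (\<lambda>n. (1 / real p) ^ n)" using assms by (intro summable_geometric) auto
  fix n :: nat
  have "real (d n) \<le> real p" using assms(2)[of n] by simp
  then have "real (d n) / real p ^ Suc n \<le> real p / real p ^ Suc n"
    by (intro divide_right_mono) auto
  then show "norm (real (d n) / real p ^ Suc n) \<le> (1 / real p) ^ n"
    using assms(1) by (simp add: power_divide)
qed

text \<open>Truncations increase to \<open>x\<close>, and truncations plus one unit in the last
  place decrease to \<open>x\<close> because each digit is at most \<open>p - 1\<close>. Terminating
  sequences are included, so both inequalities are weak.\<close>

lemma
  assumes "p \<ge> 2" "\<And>n. d n < p" "(\<lambda>n. real (d n) / real p ^ Suc n) sums x"
  shows prefix_num_le_value: "real (prefix_num p d n) / real p ^ n \<le> x"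
    and value_le_prefix_num: "x \<le> real (prefix_num p d n + 1) / real p ^ n"
proof -
  have p: "p > 0" using assms by simp
  have lim: "(\<lambda>n. real (prefix_num p d n) / real p ^ n) \<longlonglongrightarrow> x"
    using assms(3) unfolding sums_def sum_digits_eq_prefix_num[OF p] .
  have "incseq (\<lambda>n. real (prefix_num p d n) / real p ^ n)"
    using p by (intro incseq_SucI) (simp add: field_simps)
  then show "real (prefix_num p d n) / real p ^ n \<le> x" using lim by (rule incseq_le)
  have "(\<lambda>n. real (prefix_num p d n) / real p ^ n + (1 / real p) ^ n) \<longlonglongrightarrow> x + 0"
    using assms by (intro tendsto_add lim LIMSEQ_power_zero) auto
  then have lim': "(\<lambda>n. real (prefix_num p d n + 1) / real p ^ n) \<longlonglongrightarrow> x"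
    by (simp add: add_divide_distrib power_divide add.commute)
  have "decseq (\<lambda>n. real (prefix_num p d n + 1) / real p ^ n)"
  proof (rule decseq_SucI)
    fix n
    have "prefix_num p d (Suc n) + 1 \<le> p * (prefix_num p d n + 1)"
      using assms(2)[of n] by (simp add: algebra_simps)
    then have "real (prefix_num p d (Suc n) + 1) \<le> real p * real (prefix_num p d n + 1)"
      by (metis of_nat_le_iff of_nat_mult)
    then have "real (prefix_num p d (Suc n) + 1) / real p ^ Suc n \<le>
        real p * real (prefix_num p d n + 1) / real p ^ Suc n"
      by (intro divide_right_mono) auto
    also have "\<dots> = real (prefix_num p d n + 1) / real p ^ n" using p by simp
    finally show "real (prefix_num p d (Suc n) + 1) / real p ^ Suc n \<le> real (prefix_num p d n + 1) / real p ^ n" .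
  qed
  then show "x \<le> real (prefix_num p d n + 1) / real p ^ n" using lim' by (rule decseq_ge)
qed

lemma is_expansion_0_iff:
  assumes "p > 0"
  shows "is_expansion p 0 d \<longleftrightarrow> d = (\<lambda>_. 0)"
proof
  assume "is_expansion p 0 d"
  then have "(\<lambda>n. real (d n) / real p ^ Suc n) sums 0" by (simp add: is_expansion_def)
  moreover have "0 \<le> real (d n) / real p ^ Suc n" for n by simp
  ultimately have "real (d n) / real p ^ Suc n = 0" for n
    using suminf_eq_zero_iff[of "\<lambda>n. real (d n) / real p ^ Suc n"] by (auto simp: sums_iff)
  then show "d = (\<lambda>_. 0)" using assms by auto
qed (use assms in \<open>auto simp: is_expansion_def\<close>)

text \<open>A nonzero digit at or after position \<open>n\<close> makes the truncation strictly
  smaller than \<open>x\<close>. This is where non-termination enters.\<close>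

lemma prefix_num_less_value:
  assumes "p \<ge> 2" "is_expansion p x d" "x \<noteq> 0"
  shows "real (prefix_num p d n) / real p ^ n < x"
proof -
  have inf: "infinite {n. d n \<noteq> 0}" and d: "\<And>n. d n < p"
    and sums: "(\<lambda>n. real (d n) / real p ^ Suc n) sums x"
    using assms by (auto simp: is_expansion_def)
  obtain m where m: "m \<ge> n" "d m \<noteq> 0"
    using inf unfolding infinite_nat_iff_unbounded_le by auto
  have "real (prefix_num p d n) / real p ^ n = (\<Sum>i<n. real (d i) / real p ^ Suc i)"
    using assms by (subst sum_digits_eq_prefix_num) auto
  also have "\<dots> \<le> (\<Sum>i<m. real (d i) / real p ^ Suc i)"
    using m by (intro sum_mono2) auto
  also have "\<dots> < (\<Sum>i<Suc m. real (d i) / real p ^ Suc i)"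
    using m assms by simp
  also have "\<dots> = real (prefix_num p d (Suc m)) / real p ^ Suc m"
    using assms by (subst sum_digits_eq_prefix_num) auto
  also have "\<dots> \<le> x" using prefix_num_le_value[OF assms(1) d sums] .
  finally show ?thesis .
qed

text \<open>A strict lower bound from one expansion and a weak upper bound from the other give
  \<open>a < b + 1\<close> for the integer prefixes, that is \<open>a \<le> b\<close>. By symmetry
  all prefixes agree, hence all digits.\<close>

lemma is_expansion_unique:
  assumes "p \<ge> 2" "is_expansion p x d" "is_expansion p x e"
  shows "d = e"
proof (cases "x = 0")
  case True
  then show ?thesis using assms is_expansion_0_iff[of p] by auto
next
  case False
  have le: "prefix_num p d n \<le> prefix_num p e n"
    if "is_expansion p x d" "is_expansion p x e" for d e n
  proof -
    have "real (prefix_num p d n) / real p ^ n < x"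
      using prefix_num_less_value assms(1) that False by blast
    also have "x \<le> real (prefix_num p e n + 1) / real p ^ n"
      using that assms(1) by (intro value_le_prefix_num) (auto simp: is_expansion_def)
    finally have "real (prefix_num p d n) < real (prefix_num p e n + 1)"
      using assms(1) by (simp add: divide_less_cancel)
    then show ?thesis by linarith
  qed
  have "prefix_num p d n = prefix_num p e n" for n
    using le[OF assms(2,3)] le[OF assms(3,2)] by (simp add: antisym)
  then have "d n = e n" for n
    using prefix_num.simps(2)[of p d n] prefix_num.simps(2)[of p e n] by (metis add_left_cancel)
  then show ?thesis by blast
qed

lemma is_expansion_exists:
  assumes "p \<ge> 2" "0 \<le> x" "x \<le> 1"
  shows "\<exists>d. is_expansion p x d"
proof (cases "x = 0")
  case True
  then show ?thesis using is_expansion_0_iff[of p] assms by auto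
next
  case False
  then have x: "0 < x" using assms by simp
  \<comment> \<open>The prefix has to be the largest integer strictly below
    \<open>x * p ^ n\<close>, which is the ceiling minus 1; the floor would give terminating
    expansions at \<open>p\<close>-adic rationals.\<close>
  define c where "c = (\<lambda>n. nat (\<lceil>x * real p ^ n\<rceil> - 1))"
  have "0 < x * real p ^ n" for n using x assms by simp
  then have pos: "1 \<le> \<lceil>x * real p ^ n\<rceil>" for n by (simp add: one_le_ceiling)
  have c: "real (c n) < x * real p ^ n" "x * real p ^ n \<le> real (c n) + 1" for n
    using pos[of n] unfolding c_def by linarith+
  have c0: "c 0 = 0"
  proof -
    have "real (c 0) < 1" using c(1)[of 0] assms by simp
    then show ?thesis by simp
  qed
  define d where "d = (\<lambda>n. c (Suc n) - p * c n)"
  have "real p * real (c n) < real (c (Suc n)) + 1" for n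
  proof -
    have "real p * real (c n) < real p * (x * real p ^ n)" using c(1)[of n] assms by simp
    also have "\<dots> \<le> real (c (Suc n)) + 1" using c(2)[of "Suc n"] by (simp add: mult_ac)
    finally show ?thesis .
  qed
  then have le: "p * c n \<le> c (Suc n)" for n
    by (metis of_nat_less_iff of_nat_mult of_nat_Suc less_Suc_eq_le add.commute)
  have "real (c (Suc n)) < real p * (real (c n) + 1)" for n
  proof -
    have "real (c (Suc n)) < real p * (x * real p ^ n)" using c(1)[of "Suc n"] by (simp add: mult_ac)
    also have "\<dots> \<le> real p * (real (c n) + 1)" using c(2)[of n] assms by (intro mult_left_mono) auto
    finally show ?thesis .
  qed
  then have "c (Suc n) < p * (c n + 1)" for n
    by (metis of_nat_less_iff of_nat_mult of_nat_Suc Suc_eq_plus1 add.commute)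
  then have dp: "d n < p" for n
    unfolding d_def using le[of n] by (simp add: less_diff_conv2 algebra_simps)
  have cd: "c n = prefix_num p d n" for n
      proof (induction n)
    case (Suc n)
    have "c (Suc n) = p * c n + d n" using le[of n] by (simp add: d_def)
    then show ?case using Suc by simp
  qed (simp add: c0)
  have sums: "(\<lambda>n. real (d n) / real p ^ Suc n) sums x"
  proof -
    obtain z where z: "(\<lambda>n. real (d n) / real p ^ Suc n) sums z"
      using digits_summable[of p d] assms(1) dp unfolding summable_def by blast
    have "\<bar>z - x\<bar> \<le> (1 / real p) ^ n" for n
    proof -
      have "real (c n) / real p ^ n \<le> z" "z \<le> (real (c n) + 1) / real p ^ n"
        using prefix_num_le_value[OF assms(1) dp z, of n] value_le_prefix_num[OF assms(1) dp z, of n]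
        by (simp_all add: cd add_ac)
      moreover have "real (c n) / real p ^ n \<le> x" "x \<le> (real (c n) + 1) / real p ^ n"
        using c[of n] assms by (simp_all add: field_simps)
      ultimately have "\<bar>z - x\<bar> \<le> (real (c n) + 1) / real p ^ n - real (c n) / real p ^ n"
        by linarith
      then show ?thesis by (simp add: power_divide add_divide_distrib)
    qed
    moreover have "(\<lambda>n. (1 / real p) ^ n) \<longlonglongrightarrow> 0"
      using assms by (intro LIMSEQ_power_zero) auto
    ultimately have "\<bar>z - x\<bar> \<le> 0"
      by (metis LIMSEQ_le_const)
    then show ?thesis using z by simp
  qed
  \<comment> \<open>If the digits vanished from some \<open>m\<close> on, \<open>x\<close> would
    equal its truncation \<open>c m / p ^ m\<close>, which is strictly smaller by the choice of
    \<open>c\<close>.\<close>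
  have "infinite {n. d n \<noteq> 0}"
  proof
    assume "finite {n. d n \<noteq> 0}"
    then obtain m where m: "\<And>n. n \<ge> m \<Longrightarrow> d n = 0"
      unfolding finite_nat_set_iff_bounded by (metis mem_Collect_eq not_le)
    have "(\<lambda>n. real (d n) / real p ^ Suc n) sums (\<Sum>i<m. real (d i) / real p ^ Suc i)"
      using m by (intro sums_finite) auto
    then have "x = (\<Sum>i<m. real (d i) / real p ^ Suc i)" using sums sums_unique2 by blast
    also have "\<dots> = real (c m) / real p ^ m"
      using assms by (subst sum_digits_eq_prefix_num) (auto simp: cd)
    also have "\<dots> < x" using c(1)[of m] assms by (simp add: field_simps)
    finally show False by simp
  qed
  then show ?thesis using dp sums by (auto simp: is_expansion_def)
qed

lemma digits_eqI: "p \<ge> 2 \<Longrightarrow> is_expansion p x d \<Longrightarrow> digits p x = d"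
  unfolding digits_def using is_expansion_unique by blast

lemma is_expansion_digits:
  assumes "p \<ge> 2" "0 \<le> x" "x \<le> 1"
  shows "is_expansion p x (digits p x)"
  using is_expansion_exists[OF assms] digits_eqI[OF assms(1)] by auto

text \<open>For \<open>x \<noteq> 0\<close> infinitely many nonzero digits remain after dropping
  one, so the shifted sequence is again the chosen expansion. Iterates of \<open>digit_shift\<close>
  thus become translations of the index.\<close>

lemma is_expansion_shift:
  assumes "p \<ge> 2" "is_expansion p x d"
  shows "is_expansion p (digit_shift p x) (\<lambda>n. d (Suc n))"
proof -
  have d: "\<And>n. d n < p" using assms by (auto simp: is_expansion_def)
  have sums: "(\<lambda>n. real (d (Suc n)) / real p ^ Suc n) sums digit_shift p x"
    unfolding digit_shift_def digits_eqI[OF assms]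
    by (intro summable_sums digits_summable assms(1) d)
  have "infinite {n. d (Suc n) \<noteq> 0}" if "digit_shift p x \<noteq> 0"
  proof -
    have "x \<noteq> 0"
    proof
      assume "x = 0"
      then have "d = (\<lambda>_. 0)" using is_expansion_0_iff[of p d] assms by simp
      then show False using sums that sums_unique2[OF _ sums_zero, of "digit_shift p x"] by (simp add: sums_0)
    qed
    then have inf: "infinite {n. d n \<noteq> 0}" using assms by (simp add: is_expansion_def)
    have "{n. d n \<noteq> 0} \<subseteq> insert 0 (Suc ` {n. d (Suc n) \<noteq> 0})"
    proof
      fix n assume "n \<in> {n. d n \<noteq> 0}"
      then show "n \<in> insert 0 (Suc ` {n. d (Suc n) \<noteq> 0})" by (cases n) auto
    qed
    then show ?thesis using inf finite_subset by blast
  qed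
  then show ?thesis using d sums by (auto simp: is_expansion_def)
qed

lemma is_expansion_funpow_shift:
  assumes "p \<ge> 2" "is_expansion p x d"
  shows "is_expansion p ((digit_shift p ^^ m) x) (\<lambda>n. d (m + n))"
  using is_expansion_shift[OF assms(1)] assms(2) by (induction m) force+

lemma digit_sum_funpow_shift:
  assumes "p \<ge> 2" "is_expansion p x d"
  shows "digit_sum p n ((digit_shift p ^^ m) x) = (\<Sum>i<n. d (m + i))"
  unfolding digit_sum_def digits_eqI[OF assms(1) is_expansion_funpow_shift[OF assms]] ..

text \<open>A common digit \<open>0\<close> after the first difference excludes a carry.\<close>

lemma expansion_separation:
  assumes p: "p \<ge> 2" and x: "is_expansion p x d" and y: "is_expansion p y e"
    and diff: "r < q" "d r \<noteq> e r" and q: "d q = 0" "e q = 0" "q < J"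
  shows "1 / real p ^ J \<le> \<bar>x - y\<bar>"
proof -
  have main: "1 / real p ^ J \<le> y - x"
    if x: "is_expansion p x d" and y: "is_expansion p y e"
      and eq: "\<And>i. i < r \<Longrightarrow> d i = e i" and less: "d r < e r" and "r < q" "d q = 0" "q < J"
    for x y d e r
  proof -
    have d: "\<And>n. d n < p" and e: "\<And>n. e n < p" using x y by (auto simp: is_expansion_def)
    \<comment> \<open>After the first difference the gap between the integer prefixes stays at least
      1: each step multiplies it by \<open>p\<close> and the next digits take away at most
      \<open>p - 1\<close>.\<close>
    have 1: "prefix_num p e n \<ge> prefix_num p d n + 1" if "n > r" for n
      using that
    proof (induction n)
      case (Suc n)
      show ?case
      proof (cases "n = r")
        case True
        then show ?thesis using prefix_num_cong[of r d e p] eq less by simp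
      next
        case False
        then have "prefix_num p e n \<ge> prefix_num p d n + 1" using Suc by simp
        then have "p * prefix_num p e n \<ge> p * (prefix_num p d n + 1)" by (rule mult_le_mono2)
        then show ?thesis using d[of n] by simp
      qed
    qed simp
    \<comment> \<open>At position \<open>q\<close> the smaller number has digit 0, so the gap grows
      to at least \<open>p \<ge> 2\<close> and never falls below 2 again. One unit is spent on the
      tail of \<open>x\<close>, the other separates the points.\<close>
    have 2: "prefix_num p e n \<ge> prefix_num p d n + 2" if "n > q" for n
      using that
    proof (induction n)
      case (Suc n)
      show ?case
      proof (cases "n = q")
        case True
        then have "p * prefix_num p e n \<ge> p * (prefix_num p d n + 1)"
          using 1[of n] \<open>r < q\<close> by (intro mult_le_mono2) auto
        then show ?thesis using True \<open>d q = 0\<close> p by simp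
      next
        case False
        then have "prefix_num p e n \<ge> prefix_num p d n + 2" using Suc by simp
        then have "p * prefix_num p e n \<ge> p * (prefix_num p d n + 2)" by (rule mult_le_mono2)
        then show ?thesis using d[of n] p by simp
      qed
    qed simp
    have "1 / real p ^ J = real (prefix_num p d J + 2) / real p ^ J - real (prefix_num p d J + 1) / real p ^ J"
      by (simp add: diff_divide_distrib[symmetric])
    also have "real (prefix_num p d J + 2) / real p ^ J \<le> real (prefix_num p e J) / real p ^ J"
      using 2[OF \<open>q < J\<close>] by (intro divide_right_mono) auto
    also have "\<dots> \<le> y"
      using y by (intro prefix_num_le_value p e) (auto simp: is_expansion_def)
    finally have "1 / real p ^ J \<le> y - real (prefix_num p d J + 1) / real p ^ J" by simp
    moreover have "x \<le> real (prefix_num p d J + 1) / real p ^ J"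
      using x by (intro value_le_prefix_num p d) (auto simp: is_expansion_def)
    ultimately show ?thesis by simp
  qed
  define r' where "r' = (LEAST i. d i \<noteq> e i)"
  have ne: "d r' \<noteq> e r'" unfolding r'_def using diff(2) by (rule LeastI)
  have eq: "d i = e i" if "i < r'" for i using not_less_Least[of i] that unfolding r'_def by blast
  have "r' \<le> r" unfolding r'_def using diff(2) by (rule Least_le)
  then have "r' < q" using diff by simp
  show ?thesis
  proof (cases "d r' < e r'")
    case True
    then show ?thesis using main[OF x y eq True \<open>r' < q\<close> q(1,3)] by simp
  next
    case False
    then have "e r' < d r'" using ne by simp
    then show ?thesis using main[OF y x _ _ \<open>r' < q\<close> q(2,3)] eq by fastforce
  qed
qed

section \<open>Moving means\<close>

lemma sum_window_add:
  fixes v :: "nat \<Rightarrow> 'a::comm_monoid_add"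
  shows "(\<Sum>i<a+b. v (m + i)) = (\<Sum>i<a. v (m + i)) + (\<Sum>i<b. v (m + a + i))"
  by (induction b) (simp_all add: add_ac)

text \<open>Formulated for real sequences so that the lower mean is minus the upper mean of the
  negated digits.\<close>

definition moving_mean_limsup :: "(nat \<Rightarrow> real) \<Rightarrow> nat \<Rightarrow> ereal" where
  "moving_mean_limsup v n = limsup (\<lambda>m. ereal ((\<Sum>i<n. v (m + i)) / real n))"

text \<open>Fekete's argument: a window of length \<open>n\<close> splits into windows of length
  \<open>k\<close> and a remainder shorter than \<open>k\<close>, whose effect on the mean is of
  order \<open>1 / n\<close>.\<close>

lemma limsup_moving_mean_limsup_le:
  assumes bound: "\<And>i. v i \<le> C" and C: "0 \<le> C" and k: "0 < k"
  shows "limsup (moving_mean_limsup v) \<le> moving_mean_limsup v k"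
proof (rule dense_ge)
  fix c' assume less: "moving_mean_limsup v k < c'"
  show "limsup (moving_mean_limsup v) \<le> c'"
  proof (cases c')
    case (real c)
    have "\<forall>\<^sub>F m in sequentially. ereal ((\<Sum>i<k. v (m + i)) / real k) < ereal c"
      using less real unfolding moving_mean_limsup_def by (auto dest: Limsup_lessD)
    then obtain m0 where m0: "(\<Sum>i<k. v (m + i)) / real k < c" if "m \<ge> m0" for m
      by (auto simp: eventually_sequentially)
    have blocks: "(\<Sum>i<q*k. v (m + i)) \<le> real q * (c * real k)" if "m \<ge> m0" for q m
    proof (induction q)
      case (Suc q)
      have "(\<Sum>i<Suc q * k. v (m + i)) = (\<Sum>i<q*k. v (m + i)) + (\<Sum>i<k. v (m + q*k + i))"
        using sum_window_add[of v m "q*k" k] by (simp add: add.commute)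
      moreover have "(\<Sum>i<k. v (m + q*k + i)) \<le> c * real k"
        using m0[of "m + q*k"] that k by (simp add: field_simps)
      ultimately show ?case using Suc by (simp add: algebra_simps)
    qed simp
    \<comment> \<open>\<open>k * C\<close> bounds the sum over the remainder, and
      \<open>k * \<bar>c\<bar>\<close> pays for replacing \<open>c * q * k\<close> by
      \<open>c * n\<close> when \<open>c\<close> is negative.\<close>
    define K where "K = real k * (\<bar>c\<bar> + C)"
    have "moving_mean_limsup v n \<le> ereal (c + K / real n)" if "n \<ge> 1" for n
      unfolding moving_mean_limsup_def
    proof (rule Limsup_bounded, unfold eventually_sequentially, intro exI[of _ m0] allI impI)
      fix m assume m: "m \<ge> m0"
      define q r where "q = n div k" and "r = n mod k"
      have n: "n = q * k + r" by (simp add: q_def r_def)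
      have r: "r \<le> k" using k by (simp add: r_def less_imp_le)
      have "(\<Sum>i<n. v (m + i)) = (\<Sum>i<q*k. v (m + i)) + (\<Sum>i<r. v (m + q*k + i))"
        unfolding n by (rule sum_window_add)
      also have "(\<Sum>i<r. v (m + q*k + i)) \<le> (\<Sum>i<r. C)" by (intro sum_mono bound)
      also have "(\<Sum>i<r. C) \<le> real k * C" using r C by (simp add: mult_right_mono)
      also have "(\<Sum>i<q*k. v (m + i)) \<le> c * real n - c * real r"
        using blocks[OF m, of q] by (simp add: n algebra_simps)
      finally have "(\<Sum>i<n. v (m + i)) \<le> c * real n - c * real r + real k * C" by simp
      moreover have "- c * real r \<le> \<bar>c\<bar> * real k"
        using r by (intro mult_mono) auto
      ultimately have "(\<Sum>i<n. v (m + i)) \<le> c * real n + K"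
        by (simp add: K_def algebra_simps)
      then show "ereal ((\<Sum>i<n. v (m + i)) / real n) \<le> ereal (c + K / real n)"
        using that by (simp add: field_simps)
    qed
    then have "limsup (moving_mean_limsup v) \<le> limsup (\<lambda>n. ereal (c + K / real n))"
      by (intro Limsup_mono) (auto simp: eventually_sequentially)
    also have "(\<lambda>n. ereal (c + K / real n)) \<longlonglongrightarrow> ereal (c + 0)"
      by (intro tendsto_intros lim_const_over_n)
    then have "limsup (\<lambda>n. ereal (c + K / real n)) = ereal c"
      by (intro lim_imp_Limsup) auto
    finally show ?thesis by (simp add: real)
  qed (use less in auto)
qed

text \<open>The limsup lies below every term of positive index, hence below the liminf. Thus the
  \<open>lim\<close> in the definitions of the moving means is a genuine limit.\<close>

lemma moving_mean_limsup_convergent: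
  assumes "\<And>i. v i \<le> C" "0 \<le> C"
  shows "moving_mean_limsup v \<longlonglongrightarrow> lim (moving_mean_limsup v)"
proof -
  have "limsup (moving_mean_limsup v) \<le> liminf (moving_mean_limsup v)"
  proof (rule Liminf_bounded)
    show "\<forall>\<^sub>F k in sequentially. limsup (moving_mean_limsup v) \<le> moving_mean_limsup v k"
      using eventually_gt_at_top[of 0]
      by eventually_elim (rule limsup_moving_mean_limsup_le[OF assms])
  qed
  then have "liminf (moving_mean_limsup v) = limsup (moving_mean_limsup v)"
    by (simp add: antisym Liminf_le_Limsup)
  then have "moving_mean_limsup v \<longlonglongrightarrow> limsup (moving_mean_limsup v)"
    by (intro Liminf_eq_Limsup) auto
  then show ?thesis by (simp add: limI)
qed

text \<open>A discrepancy bounded by \<open>C\<close> alters window sums by at most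
  \<open>2 * C\<close>, hence means by \<open>2 * C / n\<close>. Target windows have mean at most
  \<open>b\<close>, with equality at arbitrarily late places by \<open>runs\<close>.\<close>

lemma moving_mean_limsup_tendsto:
  assumes close: "\<And>q. \<bar>(\<Sum>i<q. v i) - (\<Sum>i<q. \<tau> i)\<bar> \<le> C"
    and le: "\<And>i. \<tau> i \<le> b"
    and runs: "\<And>L m0. \<exists>m\<ge>m0. \<forall>i<L. \<tau> (m + i) = b"
  shows "moving_mean_limsup v \<longlonglongrightarrow> ereal b"
proof -
  have diff: "\<bar>(\<Sum>i<n. v (m + i)) - (\<Sum>i<n. \<tau> (m + i))\<bar> \<le> 2 * C" for n m
    using close[of m] close[of "m + n"] sum_window_add[of v 0 m n] sum_window_add[of \<tau> 0 m n]
    by (simp add: abs_le_iff)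
  have upper: "moving_mean_limsup v n \<le> ereal (b + 2 * C / real n)" if "n \<ge> 1" for n
    unfolding moving_mean_limsup_def
  proof (rule Limsup_bounded, rule always_eventually, rule allI)
    fix m
    have "(\<Sum>i<n. \<tau> (m + i)) \<le> (\<Sum>i<n. b)" by (intro sum_mono le)
    then have "(\<Sum>i<n. v (m + i)) \<le> b * real n + 2 * C"
      using diff[where m=m and n=n] by (simp add: abs_le_iff mult.commute)
    then show "ereal ((\<Sum>i<n. v (m + i)) / real n) \<le> ereal (b + 2 * C / real n)"
      using that by (simp add: field_simps)
  qed
  have lower: "ereal (b - 2 * C / real n) \<le> moving_mean_limsup v n" if "n \<ge> 1" for n
  proof (rule ccontr)
    assume "\<not> ?thesis"
    then have "limsup (\<lambda>m. ereal ((\<Sum>i<n. v (m + i)) / real n)) < ereal (b - 2 * C / real n)"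
      by (simp add: moving_mean_limsup_def not_le)
    from Limsup_lessD[OF this] obtain m0
      where m0: "(\<Sum>i<n. v (m + i)) / real n < b - 2 * C / real n" if "m \<ge> m0" for m
      by (auto simp: eventually_sequentially)
    obtain m where m: "m \<ge> m0" "\<forall>i<n. \<tau> (m + i) = b" using runs by blast
    then have "(\<Sum>i<n. \<tau> (m + i)) = b * real n" by simp
    then have "b * real n - 2 * C \<le> (\<Sum>i<n. v (m + i))"
      using diff[where m=m and n=n] by (simp add: abs_le_iff)
    then show False using m0[OF m(1)] that by (simp add: field_simps)
  qed
  show ?thesis
  proof (rule tendsto_sandwich)
    have "(\<lambda>n. ereal (b - 2 * C / real n)) \<longlonglongrightarrow> ereal (b - 0)"
      by (intro tendsto_intros lim_const_over_n)
    then show "(\<lambda>n. ereal (b - 2 * C / real n)) \<longlonglongrightarrow> ereal b" by simp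
    have "(\<lambda>n. ereal (b + 2 * C / real n)) \<longlonglongrightarrow> ereal (b + 0)"
      by (intro tendsto_intros lim_const_over_n)
    then show "(\<lambda>n. ereal (b + 2 * C / real n)) \<longlonglongrightarrow> ereal b" by simp
  qed (use upper lower in \<open>auto simp: eventually_sequentially\<close>)
qed

section \<open>Moving means in terms of the digit sequence\<close>

lemma upper_moving_mean_eq:
  assumes "p \<ge> 2" "is_expansion p x d"
  shows "upper_moving_mean p x = lim (moving_mean_limsup (\<lambda>i. real (d i)))"
  unfolding upper_moving_mean_def moving_mean_limsup_def digit_sum_funpow_shift[OF assms] by simp

lemma lower_moving_mean_eq:
  assumes "p \<ge> 2" "is_expansion p x d"
  shows "lower_moving_mean p x = lim (\<lambda>n. - moving_mean_limsup (\<lambda>i. - real (d i)) n)"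
proof -
  have "liminf (\<lambda>m. ereal (real (digit_sum p n ((digit_shift p ^^ m) x)) / real n)) =
      - moving_mean_limsup (\<lambda>i. - real (d i)) n" for n
    unfolding moving_mean_limsup_def ereal_Liminf_uminus[symmetric] digit_sum_funpow_shift[OF assms]
    by (simp add: sum_negf)
  then show ?thesis unfolding lower_moving_mean_def by simp
qed

text \<open>Turns the iterated limits into bounds on digit windows for the covering argument. Here
  \<open>m0\<close> depends on \<open>n\<close> and \<open>x\<close>, which later leads to a
  countable union.\<close>

lemma moving_mean_level_setD:
  assumes p: "p \<ge> 2" and x: "x \<in> moving_mean_level_set p \<alpha> \<beta>" and e: "0 < e"
  shows "\<exists>n0. \<forall>n\<ge>n0. \<exists>m0. \<forall>m\<ge>m0. real n * (\<alpha> - e) < real (\<Sum>i<n. digits p x (m + i)) \<and>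
    real (\<Sum>i<n. digits p x (m + i)) < real n * (\<beta> + e)"
proof -
  have exp: "is_expansion p x (digits p x)"
    using x by (intro is_expansion_digits p) (auto simp: moving_mean_level_set_def)
  define d where "d = digits p x"
  note exp = exp[folded d_def]
  have ev: "\<forall>\<^sub>F n in sequentially. \<forall>\<^sub>F m in sequentially. (\<Sum>i<n. v (m + i)) < real n * (b + e)"
    if lim: "lim (moving_mean_limsup v) = ereal b" and v: "\<And>i. v i \<le> real p" for v b
  proof -
    have "moving_mean_limsup v \<longlonglongrightarrow> ereal b"
      using moving_mean_limsup_convergent[of v "real p"] lim v by simp
    then have "\<forall>\<^sub>F n in sequentially. moving_mean_limsup v n < ereal (b + e)"
      using e by (intro order_tendstoD(2)) auto
    then show ?thesis using eventually_gt_at_top[of 0]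
    proof eventually_elim
      case (elim n)
      then have "\<forall>\<^sub>F m in sequentially. ereal ((\<Sum>i<n. v (m + i)) / real n) < ereal (b + e)"
        unfolding moving_mean_limsup_def by (intro Limsup_lessD)
      then show ?case
        by eventually_elim (use elim in \<open>simp add: field_simps\<close>)
    qed
  qed
  have dp: "d i < p" for i using exp by (simp add: is_expansion_def)
  have "\<forall>\<^sub>F n in sequentially. \<forall>\<^sub>F m in sequentially. (\<Sum>i<n. real (d (m + i))) < real n * (\<beta> + e)"
    using x dp by (intro ev) (auto simp: moving_mean_level_set_def upper_moving_mean_eq[OF p exp] less_imp_le)
  moreover have "lim (moving_mean_limsup (\<lambda>i. - real (d i))) = ereal (- \<alpha>)"
  proof -
    \<comment> \<open>Convergence is what allows \<open>lim\<close> to be interchanged with the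
      negation.\<close>
    have "moving_mean_limsup (\<lambda>i. - real (d i)) \<longlonglongrightarrow> lim (moving_mean_limsup (\<lambda>i. - real (d i)))"
      by (rule moving_mean_limsup_convergent[of _ 0]) auto
    then have "lim (\<lambda>n. - moving_mean_limsup (\<lambda>i. - real (d i)) n) =
        - lim (moving_mean_limsup (\<lambda>i. - real (d i)))"
      by (intro limI tendsto_uminus_ereal)
    then show ?thesis
      using x by (auto simp: moving_mean_level_set_def lower_moving_mean_eq[OF p exp] ereal_uminus_eq_reorder)
  qed
  then have "\<forall>\<^sub>F n in sequentially. \<forall>\<^sub>F m in sequentially. (\<Sum>i<n. - real (d (m + i))) < real n * (- \<alpha> + e)"
    by (rule ev) (auto intro: order_trans[of _ 0])
  ultimately have "\<forall>\<^sub>F n in sequentially. \<forall>\<^sub>F m in sequentially.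
      real n * (\<alpha> - e) < real (\<Sum>i<n. d (m + i)) \<and> real (\<Sum>i<n. d (m + i)) < real n * (\<beta> + e)"
  proof eventually_elim
    case (elim n)
    then show ?case
      by eventually_elim (simp add: sum_negf algebra_simps)
  qed
  then show ?thesis by (simp add: eventually_sequentially d_def)
qed

lemma moving_mean_level_setI:
  assumes p: "p \<ge> 2" and x: "is_expansion p x d"
    and close: "\<And>q. \<bar>real (\<Sum>i<q. d i) - (\<Sum>i<q. \<tau> i)\<bar> \<le> C"
    and \<tau>: "\<And>i. \<alpha> \<le> \<tau> i" "\<And>i. \<tau> i \<le> \<beta>"
    and runs: "\<And>L m0. \<exists>m\<ge>m0. \<forall>i<L. \<tau> (m + i) = \<alpha>" "\<And>L m0. \<exists>m\<ge>m0. \<forall>i<L. \<tau> (m + i) = \<beta>"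
  shows "x \<in> moving_mean_level_set p \<alpha> \<beta>"
proof -
  have d: "\<And>n. d n < p" and s: "(\<lambda>n. real (d n) / real p ^ Suc n) sums x"
    using x by (auto simp: is_expansion_def)
  have "0 \<le> x" "x \<le> 1"
    using prefix_num_le_value[OF p d s, of 0] value_le_prefix_num[OF p d s, of 0] by auto
  moreover have "moving_mean_limsup (\<lambda>i. real (d i)) \<longlonglongrightarrow> ereal \<beta>"
    using close by (intro moving_mean_limsup_tendsto[of _ \<tau> C] \<tau> runs) auto
  then have "upper_moving_mean p x = ereal \<beta>"
    by (simp add: upper_moving_mean_eq[OF p x] limI)
  moreover have "moving_mean_limsup (\<lambda>i. - real (d i)) \<longlonglongrightarrow> ereal (- \<alpha>)"
  proof (rule moving_mean_limsup_tendsto[of _ "\<lambda>i. - \<tau> i" C])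
    show "\<bar>(\<Sum>i<q. - real (d i)) - (\<Sum>i<q. - \<tau> i)\<bar> \<le> C" for q
      using close[of q] by (simp add: sum_negf abs_le_iff)
  qed (use \<tau> runs in auto)
  then have "(\<lambda>n. - moving_mean_limsup (\<lambda>i. - real (d i)) n) \<longlonglongrightarrow> - ereal (- \<alpha>)"
    by (rule tendsto_uminus_ereal)
  then have "lower_moving_mean p x = ereal \<alpha>"
    by (simp add: lower_moving_mean_eq[OF p x] limI)
  ultimately show ?thesis by (simp add: moving_mean_level_set_def)
qed

section \<open>Entropy and the upper bound\<close>

definition words :: "nat \<Rightarrow> nat \<Rightarrow> nat list set" where
  "words p n = {w. length w = n \<and> set w \<subseteq> {0..<p}}"

lemma finite_words: "finite (words p n)"
  unfolding words_def using finite_lists_length_eq[of "{0..<p}" n] by (simp add: conj_commute)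

lemma card_words: "card (words p n) = p ^ n"
  unfolding words_def using card_lists_length_eq[of "{0..<p}" n] by (simp add: conj_commute)

lemma words_Suc: "words p (Suc n) = (\<lambda>(a, w). a # w) ` ({0..<p} \<times> words p n)"
  by (auto simp: words_def length_Suc_conv image_iff)

lemma word_count_eq:
  "word_count p t n \<delta> = card {w \<in> words p n. real n * (t - \<delta>) < real (sum_list w) \<and> real (sum_list w) < real n * (t + \<delta>)}"
  unfolding word_count_def words_def by (simp add: conj_assoc)

definition entropy_at_scale :: "nat \<Rightarrow> real \<Rightarrow> real \<Rightarrow> ereal" where
  "entropy_at_scale p t \<delta> = limsup (\<lambda>n. ereal (ln (real (word_count p t n \<delta>)) / (real n * ln (real p))))"

lemma word_count_mono: "\<delta> \<le> \<delta>' \<Longrightarrow> word_count p t n \<delta> \<le> word_count p t n \<delta>'"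
  unfolding word_count_eq
proof (intro card_mono)
  assume "\<delta> \<le> \<delta>'"
  then have "real n * (t - \<delta>') \<le> real n * (t - \<delta>)" "real n * (t + \<delta>) \<le> real n * (t + \<delta>')"
    by (intro mult_left_mono; simp)+
  then show "{w \<in> words p n. real n * (t - \<delta>) < real (sum_list w) \<and> real (sum_list w) < real n * (t + \<delta>)} \<subseteq>
      {w \<in> words p n. real n * (t - \<delta>') < real (sum_list w) \<and> real (sum_list w) < real n * (t + \<delta>')}"
    by auto
qed (auto simp: finite_words)

lemma ln_of_nat_mono: "a \<le> b \<Longrightarrow> ln (real a) \<le> ln (real b)"
  by (cases "a = 0"; cases "b = 0") auto

lemma entropy_at_scale_mono:
  assumes "p \<ge> 2" "\<delta> \<le> \<delta>'"
  shows "entropy_at_scale p t \<delta> \<le> entropy_at_scale p t \<delta>'"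
  unfolding entropy_at_scale_def
  using assms ln_of_nat_mono[OF word_count_mono[OF assms(2)]]
  by (intro Limsup_mono always_eventually allI) (auto intro!: divide_right_mono mult_nonneg_nonneg)

text \<open>The value at scale \<delta> is monotone in \<delta>, so the right-hand limit at 0 exists
  and is the infimum.\<close>

lemma entropy_fun_eq_INF:
  assumes "p \<ge> 2"
  shows "entropy_fun p t = (INF \<delta>\<in>{0<..}. entropy_at_scale p t \<delta>)" (is "_ = ?I")
proof -
  have "((entropy_at_scale p t) \<longlongrightarrow> ?I) (at_right 0)"
  proof (rule order_tendstoI)
    fix a assume a: "a < ?I"
    show "\<forall>\<^sub>F \<delta> in at_right 0. a < entropy_at_scale p t \<delta>"
      using eventually_at_right_less[of 0]
      by eventually_elim (use a in \<open>meson INF_lower greaterThan_iff less_le_trans\<close>)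
  next
    fix a assume "?I < a"
    then obtain \<delta>0 where d: "\<delta>0 > 0" "entropy_at_scale p t \<delta>0 < a" by (auto simp: INF_less_iff)
    have "\<forall>\<^sub>F \<delta> in at_right 0. \<delta> < \<delta>0" using d by (intro eventually_at_rightI[of 0 \<delta>0]) auto
    then show "\<forall>\<^sub>F \<delta> in at_right 0. entropy_at_scale p t \<delta> < a"
      by eventually_elim (use d entropy_at_scale_mono[OF assms] in \<open>meson le_less_trans less_imp_le\<close>)
  qed
  then show ?thesis
    unfolding entropy_fun_def entropy_at_scale_def[symmetric] by (intro tendsto_Lim) auto
qed

lemma entropy_fun_nonneg:
  assumes "p \<ge> 2"
  shows "0 \<le> entropy_fun p t"
  unfolding entropy_fun_eq_INF[OF assms]
proof (rule INF_greatest)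
  fix \<delta> :: real
  have "0 \<le> ln (real (word_count p t n \<delta>)) / (real n * ln (real p))" for n
    using ln_of_nat_mono[of 0 "word_count p t n \<delta>"] assms by (auto intro!: divide_nonneg_nonneg)
  then have "liminf (\<lambda>n. ereal (ln (real (word_count p t n \<delta>)) / (real n * ln (real p)))) \<ge> 0"
    by (intro Liminf_bounded) auto
  also have "liminf (\<lambda>n. ereal (ln (real (word_count p t n \<delta>)) / (real n * ln (real p)))) \<le> entropy_at_scale p t \<delta>"
    unfolding entropy_at_scale_def by (intro Liminf_le_Limsup) auto
  finally show "0 \<le> entropy_at_scale p t \<delta>" .
qed

lemma word_count_less_powr:
  assumes "p \<ge> 2" "entropy_fun p t < ereal s"
  shows "\<exists>\<delta>>0. \<forall>\<^sub>F n in sequentially. real (word_count p t n \<delta>) < real p powr (real n * s)"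
proof -
  obtain \<delta> where d: "\<delta> > 0" "entropy_at_scale p t \<delta> < ereal s"
    using assms unfolding entropy_fun_eq_INF[OF assms(1)] by (auto simp: INF_less_iff)
  have "\<forall>\<^sub>F n in sequentially. ereal (ln (real (word_count p t n \<delta>)) / (real n * ln (real p))) < ereal s"
    using Limsup_lessD d(2) unfolding entropy_at_scale_def by blast
  then have "\<forall>\<^sub>F n in sequentially. real (word_count p t n \<delta>) < real p powr (real n * s)"
    using eventually_gt_at_top[of 0]
  proof eventually_elim
    case (elim n)
    have lp: "0 < ln (real p)" using assms by simp
    show ?case
    proof (cases "word_count p t n \<delta> = 0")
      case False
      have "ln (real (word_count p t n \<delta>)) < s * (real n * ln (real p))"
        using elim lp by (simp add: pos_divide_less_eq)
      also have "\<dots> = ln (real p powr (real n * s))" using assms by (simp add: ln_powr)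
      finally show ?thesis using False assms by (subst (asm) ln_less_cancel_iff) auto
    qed (use assms in simp)
  qed
  then show ?thesis using d by blast
qed

lemma card_window_words_less_powr:
  assumes p: "p \<ge> 2" and "\<alpha> \<le> \<beta>" and s: "(SUP t\<in>{\<alpha>..\<beta>}. entropy_fun p t) < ereal s"
  shows "\<exists>e>0. \<forall>\<^sub>F n in sequentially.
    real (card {w \<in> words p n. real n * (\<alpha> - e) < real (sum_list w) \<and> real (sum_list w) < real n * (\<beta> + e)})
      < real p powr (real n * s)"
proof -
  \<comment> \<open>The margin between \<open>s'\<close> and \<open>s\<close> will absorb the factor
    \<open>card T\<close>, the number of intervals in a finite subcover, once \<open>n\<close> is
    large.\<close>
  obtain s' where s': "(SUP t\<in>{\<alpha>..\<beta>}. entropy_fun p t) < ereal s'" "s' < s"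
    using s ereal_dense2[OF s] by auto
  have "\<exists>\<delta>>0. \<forall>\<^sub>F n in sequentially. real (word_count p t n \<delta>) < real p powr (real n * s')"
    if "t \<in> {\<alpha>..\<beta>}" for t
  proof (rule word_count_less_powr[OF p])
    have "entropy_fun p t \<le> (SUP t\<in>{\<alpha>..\<beta>}. entropy_fun p t)" using that by (rule SUP_upper)
    then show "entropy_fun p t < ereal s'" using s'(1) by simp
  qed
  then obtain \<delta> where \<delta>: "\<And>t. t \<in> {\<alpha>..\<beta>} \<Longrightarrow> \<delta> t > 0"
    "\<And>t. t \<in> {\<alpha>..\<beta>} \<Longrightarrow> \<forall>\<^sub>F n in sequentially. real (word_count p t n (\<delta> t)) < real p powr (real n * s')"
    by metis
  obtain T where T: "T \<subseteq> {\<alpha>..\<beta>}" "finite T" "{\<alpha>..\<beta>} \<subseteq> (\<Union>t\<in>T. ball t (\<delta> t))"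
  proof (rule compactE_image[of "{\<alpha>..\<beta>}" "{\<alpha>..\<beta>}" "\<lambda>t. ball t (\<delta> t)"])
    show "{\<alpha>..\<beta>} \<subseteq> (\<Union>t\<in>{\<alpha>..\<beta>}. ball t (\<delta> t))" using \<delta>(1) by force
  qed auto
  \<comment> \<open>An open set containing a compact interval contains a whole neighbourhood of it,
    so one \<open>e\<close> serves all \<open>n\<close>.\<close>
  obtain e where e: "e > 0" "(\<Union>x\<in>{\<alpha>..\<beta>}. ball x e) \<subseteq> (\<Union>t\<in>T. ball t (\<delta> t))"
    using compact_subset_open_imp_ball_epsilon_subset[OF compact_Icc _ T(3)] by blast
  have near: "\<exists>t\<in>T. \<bar>y - t\<bar> < \<delta> t" if "\<alpha> - e < y" "y < \<beta> + e" for y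
  proof -
    define x where "x = max \<alpha> (min \<beta> y)"
    have "x \<in> {\<alpha>..\<beta>}" "y \<in> ball x e" using that e(1) \<open>\<alpha> \<le> \<beta>\<close> by (auto simp: x_def dist_real_def)
    then have "y \<in> (\<Union>t\<in>T. ball t (\<delta> t))" using e(2) by blast
    then show ?thesis by (auto simp: dist_real_def abs_minus_commute)
  qed
  define Q where "Q = (\<lambda>n. {w \<in> words p n. real n * (\<alpha> - e) < real (sum_list w) \<and> real (sum_list w) < real n * (\<beta> + e)})"
  have "1 < real p powr (s - s')" using p s' by (intro gr_one_powr) auto
  then obtain n1 where n1: "real (card T) < (real p powr (s - s')) ^ n1"
    using real_arch_pow by blast
  have "\<forall>\<^sub>F n in sequentially. \<forall>t\<in>T. real (word_count p t n (\<delta> t)) < real p powr (real n * s')"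
    using T \<delta>(2) by (intro eventually_ball_finite) auto
  then have "\<forall>\<^sub>F n in sequentially. real (card (Q n)) < real p powr (real n * s)"
    using eventually_gt_at_top[of 0] eventually_ge_at_top[of n1]
  proof eventually_elim
    case (elim n)
    let ?R = "\<lambda>t. {w \<in> words p n. real n * (t - \<delta> t) < real (sum_list w) \<and> real (sum_list w) < real n * (t + \<delta> t)}"
    have "Q n \<subseteq> (\<Union>t\<in>T. ?R t)"
    proof
      fix w assume w: "w \<in> Q n"
      have "\<alpha> - e < real (sum_list w) / real n" "real (sum_list w) / real n < \<beta> + e"
        using w elim by (auto simp: Q_def field_simps)
      then obtain t where t: "t \<in> T" "\<bar>real (sum_list w) / real n - t\<bar> < \<delta> t" using near by blast
      then have "t - \<delta> t < real (sum_list w) / real n" "real (sum_list w) / real n < t + \<delta> t"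
        by (auto simp: abs_less_iff)
      then have "w \<in> ?R t" using w elim by (auto simp: Q_def field_simps)
      then show "w \<in> (\<Union>t\<in>T. ?R t)" using t by blast
    qed
    then have "card (Q n) \<le> card (\<Union>t\<in>T. ?R t)"
      using T by (intro card_mono) (auto simp: finite_words)
    also have "\<dots> \<le> (\<Sum>t\<in>T. word_count p t n (\<delta> t))"
      unfolding word_count_eq using T by (intro card_UN_le) auto
    finally have "real (card (Q n)) \<le> (\<Sum>t\<in>T. real (word_count p t n (\<delta> t)))"
      by (simp flip: of_nat_sum)
    also have "\<dots> \<le> (\<Sum>t\<in>T. real p powr (real n * s'))"
      using elim by (intro sum_mono) auto
    also have "\<dots> = real (card T) * real p powr (real n * s')" by simp
    also have "\<dots> < (real p powr (s - s')) ^ n * real p powr (real n * s')"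
    proof (rule mult_strict_right_mono)
      have "(real p powr (s - s')) ^ n1 \<le> (real p powr (s - s')) ^ n"
        using elim \<open>1 < real p powr (s - s')\<close> by (intro power_increasing) auto
      then show "real (card T) < (real p powr (s - s')) ^ n" using n1 by simp
    qed (use p in simp)
    also have "\<dots> = real p powr (real n * s)"
      using p by (simp add: powr_realpow[symmetric] powr_powr powr_add[symmetric] algebra_simps)
    finally show ?case .
  qed
  then show ?thesis using e(1) unfolding Q_def by blast
qed

section \<open>Covering by cylinders: the upper bound for the dimension\<close>

lemma diameter_Icc_le: "diameter {a..a + r :: real} \<le> r" if "0 \<le> r"
  using that by (intro diameter_le) (auto simp: abs_le_iff)

text \<open>Only the disjoint windows starting at \<open>m0 + j * n\<close> are used. At depth
  \<open>m0 + k * n\<close> they leave at most \<open>p ^ m0 * card Q ^ k\<close> cylinders, and the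
  \<open>s\<close>-th powers of their diameters add up to at most \<open>C * \<rho> ^ k\<close>,
  which tends to 0.\<close>

lemma hausdorff_measure_restricted_windows:
  assumes p: "p \<ge> 2" and s: "0 < s" and "0 < n" and fin: "finite Q"
    and card: "real (card Q) < real p powr (real n * s)"
  shows "hausdorff_measure s {x \<in> {0..1}. \<forall>m\<ge>m0. map (\<lambda>i. digits p x (m + i)) [0..<n] \<in> Q} = 0"
    (is "hausdorff_measure s ?X = 0")
  unfolding hausdorff_measure_eq_0_iff
proof (intro allI impI)
  fix \<delta> :: real assume \<delta>: "0 < \<delta>"
  define L where "L = rec_nat (words p m0) (\<lambda>_ A. (\<lambda>(u, w). u @ w) ` (A \<times> Q))"
  have L0: "L 0 = words p m0" and LS: "L (Suc k) = (\<lambda>(u, w). u @ w) ` (L k \<times> Q)" for k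
    by (simp_all add: L_def)
  have L: "finite (L k) \<and> card (L k) \<le> p ^ m0 * card Q ^ k" for k
  proof (induction k)
    case (Suc k)
    have "card (L (Suc k)) \<le> card (L k \<times> Q)"
      unfolding LS using Suc fin by (intro card_image_le) auto
    also have "\<dots> \<le> p ^ m0 * card Q ^ k * card Q"
      using Suc by (simp add: card_cartesian_product)
    finally show ?case using Suc fin by (simp add: LS mult_ac)
  qed (simp add: L0 finite_words card_words)
  have in_L: "map (digits p x) [0..<m0 + k * n] \<in> L k" if x: "x \<in> ?X" for x k
  proof (induction k)
    case 0
    have "is_expansion p x (digits p x)" using x by (intro is_expansion_digits p) auto
    then show ?case by (auto simp: L0 words_def is_expansion_def)
  next
    case (Suc k)
    have "map (digits p x) [0..<m0 + Suc k * n] =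
        map (digits p x) [0..<m0 + k * n] @ map (\<lambda>i. digits p x (m0 + k * n + i)) [0..<n]"
      by (rule nth_equalityI) (auto simp: nth_append)
    moreover have "map (\<lambda>i. digits p x (m0 + k * n + i)) [0..<n] \<in> Q" using x by simp
    ultimately show ?case using Suc unfolding LS by force
  qed
  \<comment> \<open>The cost factor of one more block; the hypothesis on \<open>card Q\<close> says
    exactly that it is below 1. The constant \<open>C\<close> below is the cost of the first
    \<open>m0\<close> digits, which are unrestricted.\<close>
  define \<rho> where "\<rho> = real (card Q) * real p powr - (real n * s)"
  define C where "C = real p ^ m0 * real p powr - (real m0 * s)"
  have \<rho>: "0 \<le> \<rho>" "\<rho> < 1"
    using card p by (auto simp: \<rho>_def powr_minus field_simps)
  have bound: "hausdorff_premeasure s \<delta> ?X \<le> ennreal (C * \<rho> ^ k)" if small: "1 / real p ^ (m0 + k * n) \<le> \<delta>" for k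
  proof -
    define J where "J = m0 + k * n"
    define V where "V = (\<lambda>w. {real (prefix_num p (\<lambda>i. w ! i) J) / real p ^ J ..
      real (prefix_num p (\<lambda>i. w ! i) J) / real p ^ J + 1 / real p ^ J})"
    have diam: "diameter (V w) \<le> 1 / real p ^ J" for w
      unfolding V_def by (rule diameter_Icc_le) simp
    have "hausdorff_premeasure s \<delta> ?X \<le> ennreal (\<Sum>w\<in>L k. hausdorff_gauge s (V w))"
    proof (rule hausdorff_premeasure_le_sum)
      show "?X \<subseteq> (\<Union>w\<in>L k. V w)"
      proof
        fix x assume x: "x \<in> ?X"
        then have "is_expansion p x (digits p x)" by (intro is_expansion_digits p) auto
        then have d: "\<And>i. digits p x i < p" and
          sm: "(\<lambda>n. real (digits p x n) / real p ^ Suc n) sums x" by (auto simp: is_expansion_def)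
        have "prefix_num p (\<lambda>i. map (digits p x) [0..<J] ! i) J = prefix_num p (digits p x) J"
          by (intro prefix_num_cong) auto
        then have "x \<in> V (map (digits p x) [0..<J])"
          using prefix_num_le_value[OF p d sm, of J] value_le_prefix_num[OF p d sm, of J]
          by (simp add: V_def add_divide_distrib add.commute)
        then show "x \<in> (\<Union>w\<in>L k. V w)" using in_L[OF x, of k] unfolding J_def by blast
      qed
      show "diameter (V w) \<le> \<delta>" for w using diam[of w] small by (simp add: J_def)
    qed (use L \<delta> in \<open>auto simp: V_def\<close>)
    also have "\<dots> \<le> ennreal (\<Sum>w\<in>L k. (1 / real p ^ J) powr s)"
    proof (intro ennreal_leI sum_mono)
      fix w
      have "hausdorff_gauge s (V w) \<le> diameter (V w) powr s" using s by (simp add: hausdorff_gauge_def)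
      also have "\<dots> \<le> (1 / real p ^ J) powr s"
        using s diam by (intro powr_mono2) (auto simp: diameter_ge_0 V_def)
      finally show "hausdorff_gauge s (V w) \<le> (1 / real p ^ J) powr s" .
    qed
    also have "\<dots> \<le> ennreal (C * \<rho> ^ k)"
    proof (rule ennreal_leI)
      have "(1 / real p ^ J) powr s = real p powr - (real m0 * s) * (real p powr - (real n * s)) ^ k"
        using p by (simp add: powr_realpow[symmetric] powr_powr powr_add[symmetric] powr_minus_divide[symmetric]
            J_def algebra_simps)
      then have "(\<Sum>w\<in>L k. (1 / real p ^ J) powr s) =
          real (card (L k)) * (real p powr - (real m0 * s) * (real p powr - (real n * s)) ^ k)" by simp
      also have "\<dots> \<le> real (p ^ m0 * card Q ^ k) * (real p powr - (real m0 * s) * (real p powr - (real n * s)) ^ k)"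
        using L[of k] by (intro mult_right_mono) (auto simp del: of_nat_mult of_nat_power)
      also have "\<dots> = C * \<rho> ^ k" by (simp add: C_def \<rho>_def power_mult_distrib)
      finally show "(\<Sum>w\<in>L k. (1 / real p ^ J) powr s) \<le> C * \<rho> ^ k" .
    qed
    finally show ?thesis .
  qed
  have "(\<lambda>k. (1 / real p) ^ k) \<longlonglongrightarrow> 0" using p by (intro LIMSEQ_power_zero) auto
  then have "\<forall>\<^sub>F k in sequentially. (1 / real p) ^ k < \<delta>" using \<delta> by (rule order_tendstoD)
  then have "\<forall>\<^sub>F k in sequentially. hausdorff_premeasure s \<delta> ?X \<le> ennreal (C * \<rho> ^ k)"
  proof eventually_elim
    case (elim k)
    have "k \<le> k * n" using \<open>0 < n\<close> by simp
    then have "k \<le> m0 + k * n" by linarith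
    then have "(1 / real p) ^ (m0 + k * n) \<le> (1 / real p) ^ k"
      using p by (intro power_decreasing) auto
    then show ?case using elim by (intro bound) (simp add: power_divide)
  qed
  moreover have "(\<lambda>k. ennreal (C * \<rho> ^ k)) \<longlonglongrightarrow> ennreal (C * 0)"
    using \<rho> by (intro tendsto_intros tendsto_ennrealI LIMSEQ_power_zero) auto
  ultimately have "hausdorff_premeasure s \<delta> ?X \<le> ennreal (C * 0)"
    by (intro tendsto_lowerbound[of "\<lambda>k. ennreal (C * \<rho> ^ k)" _ sequentially]) auto
  then show "hausdorff_premeasure s \<delta> ?X = 0" by simp
qed

lemma hausdorff_dim_level_set_le:
  assumes p: "p \<ge> 2" and ab: "\<alpha> \<le> \<beta>"
  shows "hausdorff_dim (moving_mean_level_set p \<alpha> \<beta>) \<le> (SUP t \<in> {\<alpha>..\<beta>}. entropy_fun p t)"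
    (is "_ \<le> ?h")
proof (rule dense_ge)
  fix s' assume s': "?h < s'"
  show "hausdorff_dim (moving_mean_level_set p \<alpha> \<beta>) \<le> s'"
  proof (cases s')
    case (real s)
    have "0 \<le> ?h"
      using entropy_fun_nonneg[OF p, of \<alpha>] ab by (meson SUP_upper2 atLeastAtMost_iff order_refl)
    then have s: "0 < s" using s' real by (metis ereal_less(2) le_less_trans)
    obtain e n0 where e: "e > 0" and n0: "\<And>n. n \<ge> n0 \<Longrightarrow>
      real (card {w \<in> words p n. real n * (\<alpha> - e) < real (sum_list w) \<and> real (sum_list w) < real n * (\<beta> + e)})
        < real p powr (real n * s)"
      using card_window_words_less_powr[OF p ab, of s] s' real
      by (auto simp: eventually_sequentially)
    define Q where "Q = (\<lambda>n. {w \<in> words p n. real n * (\<alpha> - e) < real (sum_list w) \<and> real (sum_list w) < real n * (\<beta> + e)})"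
    \<comment> \<open>The level set lies in a countable union of these sets over the window length
      and the starting place. Writing the length as \<open>n + n0 + 1\<close> keeps it positive and
      in the range where \<open>Q\<close> is small.\<close>
    define X where "X = (\<lambda>n m0. {x \<in> {0..1}. \<forall>m\<ge>m0. map (\<lambda>i. digits p x (m + i)) [0..<n] \<in> Q n})"
    have "hausdorff_measure s (X (n + n0 + 1) m0) = 0" for n m0
      unfolding X_def using n0[of "n + n0 + 1"]
      by (intro hausdorff_measure_restricted_windows p s) (auto simp: Q_def finite_words)
    then have "hausdorff_measure s (\<Union>n. \<Union>m0. X (n + n0 + 1) m0) = 0"
      by (intro hausdorff_measure_UN_null)
    moreover have "moving_mean_level_set p \<alpha> \<beta> \<subseteq> (\<Union>n. \<Union>m0. X (n + n0 + 1) m0)"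
    proof
      fix x assume x: "x \<in> moving_mean_level_set p \<alpha> \<beta>"
      then have x01: "x \<in> {0..1}" by (simp add: moving_mean_level_set_def)
      then have d: "digits p x i < p" for i
        using is_expansion_digits[OF p, of x] by (simp add: is_expansion_def)
      obtain n1 where n1: "\<And>n. n \<ge> n1 \<Longrightarrow> \<exists>m0. \<forall>m\<ge>m0. real n * (\<alpha> - e) < real (\<Sum>i<n. digits p x (m + i)) \<and>
          real (\<Sum>i<n. digits p x (m + i)) < real n * (\<beta> + e)"
        using moving_mean_level_setD[OF p x e] by blast
      define n where "n = n1 + n0 + 1"
      obtain m0 where m0: "\<And>m. m \<ge> m0 \<Longrightarrow> real n * (\<alpha> - e) < real (\<Sum>i<n. digits p x (m + i)) \<and>
          real (\<Sum>i<n. digits p x (m + i)) < real n * (\<beta> + e)"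
        using n1[of n] unfolding n_def by auto
      have "sum_list (map (\<lambda>i. digits p x (m + i)) [0..<n]) = (\<Sum>i<n. digits p x (m + i))" for m
        by (simp add: sum_list_sum_nth atLeast0LessThan)
      then have "x \<in> X n m0" using m0 d x01 by (auto simp: X_def Q_def words_def)
      then show "x \<in> (\<Union>n. \<Union>m0. X (n + n0 + 1) m0)" unfolding n_def by blast
    qed
    ultimately have "hausdorff_measure s (moving_mean_level_set p \<alpha> \<beta>) = 0"
      using hausdorff_measure_null_subset by blast
    then show ?thesis using s real by (simp add: hausdorff_dim_le)
  qed (use s' in auto)
qed

section \<open>Vanishing of the entropy at the end points\<close>

lemma sum_prod_list_words:
  fixes f :: "nat \<Rightarrow> 'a::comm_semiring_1"
  shows "(\<Sum>w\<in>words p n. prod_list (map f w)) = (\<Sum>a<p. f a) ^ n"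
proof (induction n)
  case 0
  have "words p 0 = {[]}" by (auto simp: words_def)
  then show ?case by simp
next
  case (Suc n)
  have "(\<Sum>w\<in>words p (Suc n). prod_list (map f w)) =
      (\<Sum>(a, w)\<in>{0..<p} \<times> words p n. f a * prod_list (map f w))"
    unfolding words_Suc by (subst sum.reindex) (auto simp: inj_on_def case_prod_unfold)
  also have "\<dots> = (\<Sum>a<p. f a) * (\<Sum>w\<in>words p n. prod_list (map f w))"
    by (simp add: sum_product sum.cartesian_product atLeast0LessThan)
  finally show ?case by (simp add: Suc)
qed

text \<open>Chernoff's bound: weight each word by \<open>exp (- c * cost)\<close>.\<close>

lemma card_low_cost_words_le:
  fixes g :: "nat \<Rightarrow> nat"
  assumes c: "0 \<le> c" and z: "\<And>a. a \<noteq> z \<Longrightarrow> a < p \<Longrightarrow> g a \<ge> 1"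
  shows "real (card {w \<in> words p n. real (sum_list (map g w)) \<le> real n * \<delta>}) \<le>
    exp (real n * (c * \<delta> + real p * exp (- c)))"
proof -
  define R where "R = {w \<in> words p n. real (sum_list (map g w)) \<le> real n * \<delta>}"
  have prod: "prod_list (map (\<lambda>a. exp (- c * real (g a))) w) = exp (- c * real (sum_list (map g w)))" for w
    by (induction w) (auto simp: exp_add[symmetric] algebra_simps)
  \<comment> \<open>The digit \<open>z\<close> has weight at most 1 and every other digit at most
    \<open>exp (- c)\<close>; allowing \<open>exp (- c)\<close> for \<open>z\<close> as well leads
    to the closed form below.\<close>
  have "(\<Sum>a<p. exp (- c * real (g a))) \<le> (\<Sum>a<p. exp (- c) + (if a = z then 1 else 0))"
  proof (rule sum_mono)
    fix a assume "a \<in> {..<p}"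
    show "exp (- c * real (g a)) \<le> exp (- c) + (if a = z then 1 else 0)"
    proof (cases "a = z")
      case True
      have "exp (- c * real (g a)) \<le> 1" using c by simp
      then show ?thesis using True by (simp add: add_increasing)
    next
      case False
      then have "1 \<le> real (g a)" using z[of a] \<open>a \<in> {..<p}\<close> by simp
      then have "c * 1 \<le> c * real (g a)" using c by (intro mult_left_mono)
      then show ?thesis using False by simp
    qed
  qed
  also have "\<dots> \<le> 1 + real p * exp (- c)" by (simp add: sum.distrib sum.delta)
  also have "\<dots> \<le> exp (real p * exp (- c))" by (rule exp_ge_add_one_self)
  finally have base: "(\<Sum>a<p. exp (- c * real (g a))) \<le> exp (real p * exp (- c))" .
  have "real (card R) * exp (- c * (real n * \<delta>)) = (\<Sum>w\<in>R. exp (- c * (real n * \<delta>)))" by simp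
  also have "\<dots> \<le> (\<Sum>w\<in>R. prod_list (map (\<lambda>a. exp (- c * real (g a))) w))"
    unfolding prod using c by (intro sum_mono) (auto simp: R_def intro!: mult_left_mono)
  also have "\<dots> \<le> (\<Sum>w\<in>words p n. prod_list (map (\<lambda>a. exp (- c * real (g a))) w))"
    using prod by (intro sum_mono2) (auto simp: R_def finite_words)
  also have "\<dots> \<le> exp (real p * exp (- c)) ^ n"
    unfolding sum_prod_list_words by (intro power_mono base sum_nonneg) auto
  also have "\<dots> = exp (real n * (real p * exp (- c)))" by (simp add: exp_of_nat_mult)
  finally have "real (card R) * exp (- c * (real n * \<delta>)) * exp (c * (real n * \<delta>)) \<le>
      exp (real n * (real p * exp (- c))) * exp (c * (real n * \<delta>))"
    by (intro mult_right_mono) auto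
  then have "real (card R) \<le> exp (real n * (real p * exp (- c)) + c * (real n * \<delta>))"
    by (simp add: mult.assoc flip: exp_add)
  then show ?thesis by (simp add: R_def algebra_simps)
qed

text \<open>The cost \<open>g\<close> measures how far a digit is from an extreme digit
  \<open>z\<close>. Words with mean near the end point have small total cost, so few of their digits
  differ from \<open>z\<close>, and by Chernoff's bound their growth rate tends to 0 with
  \<delta>.\<close>

lemma entropy_fun_le_0I:
  fixes g :: "nat \<Rightarrow> nat"
  assumes p: "p \<ge> 2" and z: "\<And>a. a \<noteq> z \<Longrightarrow> a < p \<Longrightarrow> g a \<ge> 1"
    and cost: "\<And>n \<delta> w. w \<in> words p n \<Longrightarrow> real n * (t - \<delta>) < real (sum_list w) \<Longrightarrow>
      real (sum_list w) < real n * (t + \<delta>) \<Longrightarrow> real (sum_list (map g w)) \<le> real n * \<delta>"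
  shows "entropy_fun p t \<le> 0"
proof (rule ereal_le_epsilon2)
  have lp: "0 < ln (real p)" using p by simp
  fix e :: real assume e: "0 < e"
  show "entropy_fun p t \<le> 0 + ereal e"
  proof -
    define e' where "e' = e * ln (real p)"
    have e': "0 < e'" using e lp by (simp add: e'_def)
    \<comment> \<open>\<open>c\<close> makes \<open>p * exp (- c)\<close> at most
      \<open>e' / 2\<close>, and then \<delta> makes \<open>c * \<delta>\<close> equal to
      \<open>e' / 2\<close>. The maximum with 1 keeps \<open>c\<close> positive.\<close>
    define c where "c = max 1 (ln (2 * real p / e'))"
    define \<delta> where "\<delta> = e' / (2 * c)"
    have c: "1 \<le> c" by (simp add: c_def)
    have \<delta>: "0 < \<delta>" using e' c by (simp add: \<delta>_def)
    have "ln (2 * real p / e') \<le> c" by (simp add: c_def)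
    then have "exp (ln (2 * real p / e')) \<le> exp c" by simp
    then have "2 * real p / e' \<le> exp c" using e' p by simp
    then have "real p * exp (- c) \<le> e' / 2" using e' by (simp add: exp_minus field_simps)
    moreover have "c * \<delta> = e' / 2" using c by (simp add: \<delta>_def)
    ultimately have exponent: "c * \<delta> + real p * exp (- c) \<le> e'" by simp
    have "ln (real (word_count p t n \<delta>)) / (real n * ln (real p)) \<le> e" if n: "n > 0" for n
    proof -
      have "word_count p t n \<delta> \<le> card {w \<in> words p n. real (sum_list (map g w)) \<le> real n * \<delta>}"
        unfolding word_count_eq using cost by (intro card_mono) (auto simp: finite_words)
      then have "real (word_count p t n \<delta>) \<le> exp (real n * (c * \<delta> + real p * exp (- c)))"
        using card_low_cost_words_le[of c z p g n \<delta>] c z by force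
      also have "\<dots> \<le> exp (real n * e')" using exponent by (simp add: mult_left_mono)
      finally have "ln (real (word_count p t n \<delta>)) \<le> real n * e'"
        using e' ln_le_cancel_iff[of "real (word_count p t n \<delta>)" "exp (real n * e')"]
        by (cases "word_count p t n \<delta> = 0") auto
      then show ?thesis using n lp by (simp add: e'_def field_simps)
    qed
    then have "entropy_at_scale p t \<delta> \<le> ereal e"
      unfolding entropy_at_scale_def
      by (intro Limsup_bounded) (auto intro: eventually_mono[OF eventually_gt_at_top[of 0]])
    then show "entropy_fun p t \<le> 0 + ereal e"
      unfolding entropy_fun_eq_INF[OF p] using \<delta> by (auto intro: INF_lower2)
  qed
qed

lemma entropy_fun_0_le: "p \<ge> 2 \<Longrightarrow> entropy_fun p 0 \<le> 0"
  by (rule entropy_fun_le_0I[where z=0 and g="\<lambda>a. a"]) auto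

lemma entropy_fun_max_le:
  assumes "p \<ge> 2"
  shows "entropy_fun p (real p - 1) \<le> 0"
proof (rule entropy_fun_le_0I[where z="p - 1" and g="\<lambda>a. p - 1 - a"])
  fix n \<delta> w assume w: "w \<in> words p n" and less: "real n * (real p - 1 - \<delta>) < real (sum_list w)"
  have "real (sum_list (map (\<lambda>a. p - 1 - a) w)) = real (length w) * (real p - 1) - real (sum_list w)"
    if "set w \<subseteq> {0..<p}" for w
    using that by (induction w) (auto simp: algebra_simps of_nat_diff)
  then have "real (sum_list (map (\<lambda>a. p - 1 - a) w)) = real n * (real p - 1) - real (sum_list w)"
    using w by (simp add: words_def)
  also have "\<dots> \<le> real n * \<delta>" using less by (simp add: algebra_simps)
  finally show "real (sum_list (map (\<lambda>a. p - 1 - a) w)) \<le> real n * \<delta>" .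
qed (use assms in auto)

section \<open>Sparse runs\<close>

text \<open>Since \<open>8 ^ j + j < 2 * 8 ^ j\<close>, run \<open>j\<close> is over well before
  \<open>8 ^ (j + 1)\<close>.\<close>

lemma sparse_runs_unique:
  fixes i j k :: nat
  assumes "8 ^ j \<le> i" "i < 8 ^ j + j" "8 ^ k \<le> i" "i < 8 ^ k + k"
  shows "j = k"
proof -
  have no: "\<not> j < k" if "i < 8 ^ j + j" "8 ^ k \<le> i" for j k
  proof
    assume "j < k"
    then have "(8::nat) ^ Suc j \<le> 8 ^ k" by (intro power_increasing) auto
    moreover have "j < 8 ^ j" by (rule less_exp[THEN less_le_trans]) (simp add: power_mono)
    ultimately show False using that by simp
  qed
  show ?thesis using no[of j k] no[of k j] assms by linarith
qed

text \<open>For \<open>8 ^ K \<le> b < 8 ^ (K + 1)\<close> only the runs \<open>0\<close> to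
  \<open>K\<close> begin below \<open>b\<close>. Their total length is at most
  \<open>(K + 1) * (K + 1) \<le> 4 ^ K\<close>, a fraction of at most \<open>(1/2) ^ K\<close> of
  \<open>b\<close>.\<close>

lemma card_sparse_runs_le:
  fixes \<theta> :: real
  assumes "\<theta> < 1"
  shows "\<forall>\<^sub>F b in sequentially. \<theta> * real b \<le> real (card {i. i < b \<and> (\<forall>k. \<not> (8 ^ k \<le> i \<and> i < 8 ^ k + k))})"
proof -
  obtain K0 where K0: "(1/2::real) ^ K0 < 1 - \<theta>"
    using real_arch_pow_inv[of "1 - \<theta>" "1/2"] assms by auto
  show ?thesis
    unfolding eventually_sequentially
  proof (intro exI[of _ "8 ^ K0"] allI impI)
    fix b :: nat assume b: "8 ^ K0 \<le> b"
    have "1 \<le> b" using b by (metis le_trans one_le_power one_le_numeral)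
    then obtain K where K: "8 ^ K \<le> b" "b < 8 ^ (K + 1)" using ex_power_ivl1[of 8 b] by auto
    have "(8::nat) ^ K0 < 8 ^ (K + 1)" using b K by linarith
    then have "K0 \<le> K" using power_less_imp_less_exp[of "8::nat" K0 "K + 1"] by simp
    let ?G = "{i. i < b \<and> (\<forall>k. \<not> (8 ^ k \<le> i \<and> i < 8 ^ k + k))}"
    let ?S = "\<Union>k\<in>{..K}. {8 ^ k..<8 ^ k + k}"
    have "{..<b} \<subseteq> ?G \<union> ?S"
    proof
      fix i assume i: "i \<in> {..<b}"
      show "i \<in> ?G \<union> ?S"
      proof (cases "\<exists>k. 8 ^ k \<le> i \<and> i < 8 ^ k + k")
        case True
        then obtain k where k: "8 ^ k \<le> i" "i < 8 ^ k + k" by blast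
        then have "(8::nat) ^ k < 8 ^ (K + 1)" using i K by auto
        then have "k \<le> K" using power_less_imp_less_exp[of "8::nat" k "K + 1"] by simp
        then show ?thesis using k by auto
      qed (use i in auto)
    qed
    then have "card {..<b} \<le> card (?G \<union> ?S)" by (intro card_mono) auto
    also have "\<dots> \<le> card ?G + card ?S" by (rule card_Un_le)
    also have "card ?S \<le> (\<Sum>k\<in>{..K}. card {(8::nat) ^ k..<8 ^ k + k})" by (intro card_UN_le) auto
    also have "\<dots> \<le> (\<Sum>k\<in>{..K}. K + 1)" by (intro sum_mono) auto
    also have "\<dots> = (K + 1) * (K + 1)" by simp
    also have "\<dots> \<le> 2 ^ K * 2 ^ K"
      using less_exp[of K] by (intro mult_le_mono; simp only: Suc_eq_plus1[symmetric] Suc_le_eq)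
    finally have "real b \<le> real (card ?G) + real (2 ^ K * 2 ^ K)"
      by (metis (no_types, lifting) add_left_mono card_lessThan of_nat_add of_nat_le_iff)
    moreover have "real (2 ^ K * 2 ^ K) \<le> (1 - \<theta>) * real b"
    proof -
      have "real (2 ^ K * 2 ^ K) = (1/2) ^ K * real (8 ^ K)"
        by (simp flip: power_mult_distrib)
      also have "\<dots> \<le> (1/2) ^ K0 * real b"
        using K \<open>K0 \<le> K\<close> by (intro mult_mono power_decreasing) (auto simp flip: of_nat_le_iff)
      also have "\<dots> \<le> (1 - \<theta>) * real b" using K0 by (intro mult_right_mono) auto
      finally show ?thesis .
    qed
    ultimately show "\<theta> * real b \<le> real (card ?G)" by (simp add: algebra_simps)
  qed
qed

text \<open>Runs of even index carry \<alpha>, those of odd index \<beta>, and \<open>F\<close>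
  marks the places outside all runs, where the target is \<open>t\<close>. The argument of \<tau>
  will number blocks of digits, not single digits.\<close>

lemma target_schedule_exists:
  fixes \<alpha> \<beta> t :: real
  assumes "\<alpha> \<le> t" "t \<le> \<beta>"
  obtains \<tau> :: "nat \<Rightarrow> real" and F :: "nat \<Rightarrow> bool" where
    "\<And>b. \<alpha> \<le> \<tau> b" "\<And>b. \<tau> b \<le> \<beta>" "\<And>b. F b \<Longrightarrow> \<tau> b = t"
    "\<And>L m. \<exists>b\<ge>m. \<forall>i<L. \<tau> (b + i) = \<alpha>" "\<And>L m. \<exists>b\<ge>m. \<forall>i<L. \<tau> (b + i) = \<beta>"
    "\<And>\<theta>::real. \<theta> < 1 \<Longrightarrow> \<forall>\<^sub>F b in sequentially. \<theta> * real b \<le> real (card {i. i < b \<and> F i})"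
proof -
  define run where "run = (\<lambda>par i. \<exists>k::nat. even k = par \<and> 8 ^ k \<le> i \<and> i < 8 ^ k + k)"
  define \<tau> where "\<tau> = (\<lambda>i. if run True i then \<alpha> else if run False i then \<beta> else t)"
  define F where "F = (\<lambda>i. \<forall>k::nat. \<not> (8 ^ k \<le> i \<and> i < 8 ^ k + k))"
  have long: "\<exists>b\<ge>m. \<forall>i<L. run par (b + i)" for par m L
  proof -
    \<comment> \<open>Of the prescribed parity and at least as large as \<open>m\<close> and
      \<open>L\<close>, so that run \<open>k\<close> starts late enough and is long enough.\<close>
    define k where "k = 2 * (m + L) + (if par then 0 else 1)"
    have "k < 8 ^ k" by (rule less_exp[THEN less_le_trans]) (simp add: power_mono)
    then have "m \<le> 8 ^ k" by (simp add: k_def)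
    moreover have "run par (8 ^ k + i)" if "i < L" for i
      unfolding run_def using that by (intro exI[of _ k]) (auto simp: k_def)
    ultimately show ?thesis by blast
  qed
  have excl: "\<not> run True i" if "run False i" for i
    using that sparse_runs_unique unfolding run_def by metis
  show thesis
  proof
    show "\<exists>b\<ge>m. \<forall>i<L. \<tau> (b + i) = \<alpha>" for L m using long[of m L True] by (auto simp: \<tau>_def)
    show "\<exists>b\<ge>m. \<forall>i<L. \<tau> (b + i) = \<beta>" for L m using long[of m L False] excl by (auto simp: \<tau>_def)
    show "\<forall>\<^sub>F b in sequentially. \<theta> * real b \<le> real (card {i. i < b \<and> F i})" if "\<theta> < 1" for \<theta>
      unfolding F_def by (rule card_sparse_runs_le[OF that])
  qed (use assms in \<open>auto simp: \<tau>_def F_def run_def\<close>)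
qed

section \<open>The block construction\<close>

text \<open>A free block has \<open>n\<close> positions for a word of \<open>W\<close>, followed by
  \<open>c\<close> correcting positions. Each correction moves the digit sum towards the target by
  at least \<mu>, hence the deviation \<open>c * \<mu>\<close> allowed in \<open>W_sum\<close>. In
  \<open>W_end\<close> the digit 1 secures non-termination and the final 0 prevents carries.\<close>

locale block_scheme =
  fixes p n c :: nat and W :: "nat list set" and \<tau> :: "nat \<Rightarrow> real" and F :: "nat \<Rightarrow> bool"
    and \<alpha> \<beta> t \<mu> :: real
  assumes p: "p \<ge> 2" and n: "n \<ge> 2"
    and W_words: "W \<subseteq> words p n"
    and W_end: "w \<in> W \<Longrightarrow> w ! (n - 2) = 1" "w \<in> W \<Longrightarrow> w ! (n - 1) = 0"
    and W_sum: "w \<in> W \<Longrightarrow> \<bar>real (sum_list w) - real n * t\<bar> \<le> real c * \<mu>"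
    and \<mu>: "0 \<le> \<mu>" "\<mu> \<le> t" "t \<le> real p - 1 - \<mu>"
    and ab: "0 \<le> \<alpha>" "\<beta> \<le> real p - 1"
    and \<tau>: "\<alpha> \<le> \<tau> b" "\<tau> b \<le> \<beta>" "F b \<Longrightarrow> \<tau> b = t"
    and runs: "\<exists>b\<ge>m. \<forall>i<L. \<tau> (b + i) = \<alpha>" "\<exists>b\<ge>m. \<forall>i<L. \<tau> (b + i) = \<beta>"
    and F_dense: "\<And>\<theta>::real. \<theta> < 1 \<Longrightarrow> \<forall>\<^sub>F b in sequentially. \<theta> * real b \<le> real (card {i. i < b \<and> F i})"
begin

definition N :: nat where "N = n + c"

definition target_sum :: "nat \<Rightarrow> real" where "target_sum q = (\<Sum>i<q. \<tau> (i div N))"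

definition choice_pos :: "nat \<Rightarrow> bool" where "choice_pos q \<longleftrightarrow> F (q div N) \<and> q mod N < n"

text \<open>Outside the freely chosen words the digit is the one that pushes the running digit sum
  towards \<open>target_sum\<close>.\<close>

fun run_sum :: "(nat \<Rightarrow> nat list) \<Rightarrow> nat \<Rightarrow> nat" where
  "run_sum u 0 = 0"
| "run_sum u (Suc q) = run_sum u q +
    (if choice_pos q then u (q div N) ! (q mod N) else if target_sum q < real (run_sum u q) then 0 else p - 1)"

text \<open>The recursion is on the running sum because the control depends on it; the digit is
  recovered as its increment.\<close>

definition digit :: "(nat \<Rightarrow> nat list) \<Rightarrow> nat \<Rightarrow> nat" where
  "digit u q = run_sum u (Suc q) - run_sum u q"

definition point :: "(nat \<Rightarrow> nat list) \<Rightarrow> real" where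
  "point u = (\<Sum>q. real (digit u q) / real p ^ Suc q)"

lemma N_pos: "0 < N" using n by (simp add: N_def)

lemma run_sum_Suc: "run_sum u (Suc q) = run_sum u q + digit u q"
  by (simp add: digit_def)

lemma digit_choice: "choice_pos q \<Longrightarrow> digit u q = u (q div N) ! (q mod N)"
  by (simp add: digit_def)

lemma digit_control: "\<not> choice_pos q \<Longrightarrow> digit u q = (if target_sum q < real (run_sum u q) then 0 else p - 1)"
  by (simp add: digit_def)

lemma sum_digit: "(\<Sum>i<q. digit u i) = run_sum u q"
  by (induction q) (simp_all add: run_sum_Suc del: run_sum.simps(2))

lemma block_pos:
  assumes "F b" "r < n"
  shows "choice_pos (b * N + r)" "digit u (b * N + r) = u b ! r"
proof -
  have "r < N" using assms by (simp add: N_def)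
  then have "(b * N + r) div N = b" "(b * N + r) mod N = r" by simp_all
  then show "choice_pos (b * N + r)" using assms by (simp add: choice_pos_def)
  then show "digit u (b * N + r) = u b ! r"
    using \<open>(b * N + r) div N = b\<close> \<open>(b * N + r) mod N = r\<close> by (simp add: digit_choice)
qed

lemma \<tau>_bounds: "0 \<le> \<tau> b" "\<tau> b \<le> real p - 1"
  using \<tau>(1,2)[of b] ab by linarith+

section \<open>Boundedness of the discrepancy\<close>

definition disc :: "(nat \<Rightarrow> nat list) \<Rightarrow> nat \<Rightarrow> real" where
  "disc u q = real (run_sum u q) - target_sum q"

lemma disc_Suc: "disc u (Suc q) = disc u q + real (digit u q) - \<tau> (q div N)"
  by (simp add: disc_def run_sum_Suc target_sum_def del: run_sum.simps(2))

text \<open>A digit 0 lowers a positive discrepancy by \<tau>, a digit \<open>p - 1\<close> raises a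
  nonpositive one by \<open>p - 1 - \<tau>\<close>; both steps lie between \<open>m\<close> and
  \<open>p - 1\<close>. So the modulus drops by at least \<open>m\<close> unless zero is crossed,
  and then it is at most \<open>p\<close>.\<close>

lemma disc_control:
  assumes "\<not> choice_pos q" "0 \<le> m" "m \<le> \<tau> (q div N)" "\<tau> (q div N) \<le> real p - 1 - m"
  shows "\<bar>disc u (Suc q)\<bar> \<le> max (real p) (\<bar>disc u q\<bar> - m)"
proof (cases "target_sum q < real (run_sum u q)")
  case True
  then have "0 < disc u q" by (simp add: disc_def)
  moreover have "disc u (Suc q) = disc u q - \<tau> (q div N)"
    using True assms by (simp add: disc_Suc digit_control)
  ultimately show ?thesis using assms by (auto simp: abs_le_iff max_def)
next
  case False
  then have "disc u q \<le> 0" by (simp add: disc_def)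
  moreover have "disc u (Suc q) = disc u q + (real p - 1) - \<tau> (q div N)"
    using False assms p by (simp add: disc_Suc digit_control of_nat_diff)
  ultimately show ?thesis using assms by (auto simp: abs_le_iff max_def)
qed

lemma disc_control_iter:
  assumes "0 \<le> m" "\<And>i. i < j \<Longrightarrow> \<not> choice_pos (q + i)"
    "\<And>i. i < j \<Longrightarrow> m \<le> \<tau> ((q + i) div N)" "\<And>i. i < j \<Longrightarrow> \<tau> ((q + i) div N) \<le> real p - 1 - m"
  shows "\<bar>disc u (q + j)\<bar> \<le> max (real p) (\<bar>disc u q\<bar> - real j * m)"
  using assms
proof (induction j)
  case (Suc j)
  have "\<bar>disc u (q + j)\<bar> \<le> max (real p) (\<bar>disc u q\<bar> - real j * m)" using Suc by simp
  moreover have "\<bar>disc u (Suc (q + j))\<bar> \<le> max (real p) (\<bar>disc u (q + j)\<bar> - m)"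
    using Suc.prems by (intro disc_control) auto
  ultimately show ?case using \<open>0 \<le> m\<close> by (auto simp: algebra_simps max_def split: if_splits)
qed simp

lemma disc_block_word:
  assumes "F b" "u b \<in> W"
  shows "\<bar>disc u (b * N + n)\<bar> \<le> \<bar>disc u (b * N)\<bar> + real c * \<mu>"
proof -
  have len: "length (u b) = n" using assms W_words by (auto simp: words_def)
  have "disc u (b * N + r) = disc u (b * N) + (\<Sum>i<r. real (u b ! i)) - real r * t" if "r \<le> n" for r
    using that
  proof (induction r)
    case (Suc r)
    have "(b * N + r) div N = b" using Suc.prems by (simp add: N_def)
    then have "disc u (Suc (b * N + r)) = disc u (b * N + r) + real (u b ! r) - t"
      using Suc.prems assms by (simp add: disc_Suc block_pos \<tau>)
    then show ?case using Suc by (simp add: algebra_simps)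
  qed simp
  from this[of n] have "disc u (b * N + n) = disc u (b * N) + (real (sum_list (u b)) - real n * t)"
    by (simp add: sum_list_sum_nth len atLeast0LessThan)
  then show ?thesis using W_sum[OF assms(2)] by linarith
qed

text \<open>In a free block the word adds at most \<open>c * \<mu>\<close> and the \<open>c\<close>
  corrections take it off again, so the bound \<open>p\<close> is reproduced at the start of the
  next block.\<close>

lemma disc_block_start:
  assumes u: "\<And>b. u b \<in> W"
  shows "\<bar>disc u (b * N)\<bar> \<le> real p"
proof (induction b)
  case 0
  then show ?case by (simp add: disc_def target_sum_def)
next
  case (Suc b)
  have div: "(b * N + i) div N = b" if "i < N" for i using that by simp
  show ?case
  proof (cases "F b")
    case True
    have "\<bar>disc u (b * N + n + c)\<bar> \<le> max (real p) (\<bar>disc u (b * N + n)\<bar> - real c * \<mu>)"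
    proof (rule disc_control_iter)
      fix i assume i: "i < c"
      then have eq: "(b * N + n + i) div N = b" "(b * N + n + i) mod N = n + i"
        using div[of "n + i"] by (simp_all add: N_def add.assoc)
      show "\<not> choice_pos (b * N + n + i)" unfolding choice_pos_def eq by simp
      show "\<mu> \<le> \<tau> ((b * N + n + i) div N)" "\<tau> ((b * N + n + i) div N) \<le> real p - 1 - \<mu>"
        unfolding eq using \<tau>(3)[OF True] \<mu> by simp_all
    qed (rule \<mu>)
    then show ?thesis using disc_block_word[of b u, OF True u] Suc by (simp add: N_def algebra_simps)
  next
    case False
    \<comment> \<open>Outside \<open>F\<close> the target slope may be 0 or \<open>p - 1\<close>, so
      the control is only applied with \<open>m = 0\<close>; this suffices to keep the bound
      \<open>p\<close>.\<close>
    have "\<bar>disc u (b * N + N)\<bar> \<le> max (real p) (\<bar>disc u (b * N)\<bar> - real N * 0)"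
      using False \<tau>_bounds div by (intro disc_control_iter) (auto simp: choice_pos_def)
    then show ?thesis using Suc by (simp add: add.commute)
  qed
qed

lemma digit_less:
  assumes "\<And>b. u b \<in> W"
  shows "digit u q < p"
proof (cases "choice_pos q")
  case True
  have "u (q div N) \<in> words p n" using assms W_words by blast
  then have "set (u (q div N)) \<subseteq> {0..<p}" "q mod N < length (u (q div N))"
    using True by (auto simp: words_def choice_pos_def)
  then show ?thesis using True nth_mem by (fastforce simp: digit_choice)
qed (use p in \<open>simp add: digit_control\<close>)

lemma disc_bound:
  assumes u: "\<And>b. u b \<in> W"
  shows "\<bar>disc u q\<bar> \<le> real p + real N * real p"
proof -
  have "\<bar>disc u (b * N + r)\<bar> \<le> real p + real r * real p" for b r
  proof (induction r)
    case 0
    then show ?case using disc_block_start[OF u] by simp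
  next
    case (Suc r)
    have "\<bar>disc u (Suc (b * N + r))\<bar> \<le> \<bar>disc u (b * N + r)\<bar> + real p"
      using digit_less[of u "b * N + r", OF u] \<tau>_bounds[of "(b * N + r) div N"] unfolding disc_Suc
      by linarith
    then show ?case using Suc by (simp add: algebra_simps)
  qed
  from this[of "q div N" "q mod N"] have "\<bar>disc u q\<bar> \<le> real p + real (q mod N) * real p"
    unfolding div_mult_mod_eq .
  also have "\<dots> \<le> real p + real N * real p"
    using N_pos by (intro add_left_mono mult_right_mono) (auto simp: less_imp_le)
  finally show ?thesis .
qed

section \<open>The points of the construction and their separation\<close>

lemma card_free_unbounded: "\<exists>b. k \<le> card {i. i < b \<and> F i}"
proof -
  obtain b0 where b0: "\<And>b. b \<ge> b0 \<Longrightarrow> 1/2 * real b \<le> real (card {i. i < b \<and> F i})"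
    using F_dense[of "1/2"] by (auto simp: eventually_sequentially)
  have "real k \<le> 1/2 * real (b0 + 2 * k)" by simp
  also have "\<dots> \<le> real (card {i. i < b0 + 2 * k \<and> F i})" by (rule b0) simp
  finally show ?thesis by (auto simp only: of_nat_le_iff)
qed

lemma infinite_free: "infinite {b. F b}"
proof
  assume fin: "finite {b. F b}"
  obtain b where "Suc (card {b. F b}) \<le> card {i. i < b \<and> F i}" using card_free_unbounded by blast
  also have "\<dots> \<le> card {b. F b}" using fin by (intro card_mono) auto
  finally show False by simp
qed

lemma is_expansion_point:
  assumes u: "\<And>b. u b \<in> W"
  shows "is_expansion p (point u) (digit u)"
proof -
  \<comment> \<open>Position \<open>n - 2\<close> of every word of \<open>W\<close> holds a 1, and
    infinitely many blocks are free.\<close>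
  have "infinite {q. digit u q \<noteq> 0}"
  proof (rule infinite_super)
    show "(\<lambda>b. b * N + (n - 2)) ` {b. F b} \<subseteq> {q. digit u q \<noteq> 0}"
      using n W_end(1)[OF u] block_pos(2)[where r="n - 2"] by auto
    have "inj_on (\<lambda>b. b * N + (n - 2)) {b. F b}" using N_pos by (auto simp: inj_on_def)
    then show "infinite ((\<lambda>b. b * N + (n - 2)) ` {b. F b})"
      using infinite_free by (simp add: finite_image_iff)
  qed
  moreover have "(\<lambda>q. real (digit u q) / real p ^ Suc q) sums point u"
    unfolding point_def by (intro summable_sums digits_summable p digit_less u)
  ultimately show ?thesis using digit_less[OF u] by (simp add: is_expansion_def)
qed

lemma point_in_level_set:
  assumes u: "\<And>b. u b \<in> W"
  shows "point u \<in> moving_mean_level_set p \<alpha> \<beta>"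
proof (rule moving_mean_level_setI[OF p is_expansion_point[OF u]])
  show "\<bar>real (\<Sum>i<q. digit u i) - (\<Sum>i<q. \<tau> (i div N))\<bar> \<le> real p + real N * real p" for q
    using disc_bound[of u q, OF u] unfolding sum_digit disc_def target_sum_def .
  \<comment> \<open>A run of \<open>L\<close> blocks from \<open>b\<close> on contains the
    \<open>L\<close> digit positions that follow \<open>b * N\<close>, because
    \<open>N \<ge> 1\<close>.\<close>
  have long: "\<exists>m\<ge>m0. \<forall>i<L. \<tau> ((m + i) div N) = a"
    if ex: "\<exists>b\<ge>m0. \<forall>i<L. \<tau> (b + i) = a" for L m0 a
  proof -
    obtain b where b: "b \<ge> m0" "\<forall>i<L. \<tau> (b + i) = a" using ex by blast
    show ?thesis
    proof (intro exI[of _ "b * N"] conjI allI impI)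
      have "b \<le> b * N" using N_pos by simp
      then show "m0 \<le> b * N" using b by linarith
      fix i assume "i < L"
      then have "i div N < L" by (meson div_le_dividend le_less_trans)
      moreover have "(b * N + i) div N = b + i div N" using N_pos by simp
      ultimately show "\<tau> ((b * N + i) div N) = a" using b by simp
    qed
  qed
  show "\<exists>m\<ge>m0. \<forall>i<L. \<tau> ((m + i) div N) = \<alpha>" "\<exists>m\<ge>m0. \<forall>i<L. \<tau> ((m + i) div N) = \<beta>" for L m0
    by (rule long, rule runs)+
qed (use \<tau> in auto)

text \<open>Distinct words of \<open>W\<close> differ before their last position, where both have 0.
  This common 0 lies in the same block and after the difference, so the points are separated at
  depth \<open>Suc b * N\<close>.\<close>

lemma point_separation:
  assumes u: "\<And>b. u b \<in> W" and v: "\<And>b. v b \<in> W" and "F b" "u b \<noteq> v b"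
  shows "1 / real p ^ (Suc b * N) \<le> dist (point u) (point v)"
proof -
  have len: "length (u b) = n" "length (v b) = n" using u v W_words by (auto simp: words_def)
  then obtain r where r: "r < n" "u b ! r \<noteq> v b ! r"
    using \<open>u b \<noteq> v b\<close> nth_equalityI[of "u b" "v b"] by auto
  have "r \<noteq> n - 1" using r W_end(2)[OF u] W_end(2)[OF v] by metis
  then have "b * N + r < b * N + (n - 1)" using r by simp
  moreover have "digit u (b * N + r) \<noteq> digit v (b * N + r)" using r \<open>F b\<close> by (simp add: block_pos)
  moreover have "digit u (b * N + (n - 1)) = 0" "digit v (b * N + (n - 1)) = 0"
    using n W_end(2)[OF u] W_end(2)[OF v] block_pos(2)[OF \<open>F b\<close>, of "n - 1"] by auto
  moreover have "b * N + (n - 1) < Suc b * N" using n by (simp add: N_def)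
  ultimately show ?thesis
    unfolding dist_real_def by (rule expansion_separation[OF p is_expansion_point[OF u] is_expansion_point[OF v]])
qed

text \<open>The words in the free blocks are read off from the expansion of \<open>y\<close> in base \<open>card W\<close>.\<close>

lemma hausdorff_measure_level_set_neq_0:
  assumes s: "0 \<le> s" and M: "real p powr (real N * s) < real (card W)"
  shows "hausdorff_measure s (moving_mean_level_set p \<alpha> \<beta>) \<noteq> 0"
proof -
  define M where "M = card W"
  have "1 \<le> real p powr (real N * s)" using p s by (intro ge_one_powr_ge_zero) auto
  then have M2: "2 \<le> M" using M by (simp add: M_def)
  have finW: "finite W" using W_words finite_words finite_subset by blast
  obtain wd where wd: "bij_betw wd {0..<M} W"
    unfolding M_def using ex_bij_betw_nat_finite[OF finW] by blast
  \<comment> \<open>\<open>P b\<close> counts the choices in the free blocks before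
    \<open>b\<close>, and \<open>a b y\<close> is the integer formed by as many
    base-\<open>M\<close> digits of \<open>y\<close> as there are such blocks. For free
    \<open>b\<close>, the residue of \<open>a (Suc b) y\<close> modulo \<open>M\<close> is the digit
    that selects the word of block \<open>b\<close>.\<close>
  define P where "P = (\<lambda>b. M ^ card {i. i < b \<and> F i})"
  define a where "a = (\<lambda>b (y::real). nat \<lfloor>y * real (P b)\<rfloor>)"
  define u where "u = (\<lambda>y b. wd (a (Suc b) y mod M))"
  have uW: "u y b \<in> W" for y b
    unfolding u_def using wd M2 by (auto simp: bij_betw_def)
  have P_pos: "0 < P b" for b using M2 by (simp add: P_def)
  have P_Suc: "P (Suc b) = (if F b then M * P b else P b)" for b
  proof -
    have "{i. i < Suc b \<and> F i} = (if F b then insert b {i. i < b \<and> F i} else {i. i < b \<and> F i})"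
      by (auto simp: less_Suc_eq)
    then show ?thesis by (simp add: P_def)
  qed
  have a_div: "a (Suc b) y div M = a b y" if "F b" "0 \<le> y" for b y
  proof -
    have "y * real (P b) = (y * real (P (Suc b))) / real M" using M2 that by (simp add: P_Suc)
    then have "\<lfloor>y * real (P b)\<rfloor> = \<lfloor>y * real (P (Suc b))\<rfloor> div int M"
      using floor_divide_real_eq_div[of "int M" "y * real (P (Suc b))"] by simp
    then show ?thesis unfolding a_def by (simp add: nat_div_distrib that)
  qed
  have close: "\<bar>y - y'\<bar> \<le> 1 / real (P b)" if "a b y = a b y'" "0 \<le> y" "0 \<le> y'" for b y y'
  proof -
    have "\<lfloor>y * real (P b)\<rfloor> = \<lfloor>y' * real (P b)\<rfloor>"
      using that unfolding a_def by (subst (asm) nat_eq_iff) auto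
    then have "\<bar>y * real (P b) - y' * real (P b)\<bar> \<le> 1" by linarith
    then have "\<bar>y - y'\<bar> * real (P b) \<le> 1" by (simp add: left_diff_distrib[symmetric] abs_mult)
    then show ?thesis using P_pos[of b] by (simp add: field_simps)
  qed
  \<comment> \<open>The first index at which \<open>a\<close> tells \<open>y\<close> from
    \<open>y'\<close> is the successor of a free block \<open>b\<close>. At \<open>b\<close> the
    integers still agree, which bounds the distance by \<open>1 / P b\<close>.\<close>
  have split: "\<exists>b. F b \<and> u y b \<noteq> u y' b \<and> \<bar>y - y'\<bar> \<le> 1 / real (P b)"
    if y: "y \<in> {0..<1}" "y' \<in> {0..<1}" "y \<noteq> y'" for y y'
  proof -
    have "\<exists>b. a b y \<noteq> a b y'"
    proof (rule ccontr)
      assume "\<not> ?thesis"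
      then have le: "\<bar>y - y'\<bar> \<le> 1 / real (P b)" for b using close y by auto
      obtain k where k: "(1/2) ^ k < \<bar>y - y'\<bar>"
        using real_arch_pow_inv[of "\<bar>y - y'\<bar>" "1/2"] y by auto
      obtain b where b: "k \<le> card {i. i < b \<and> F i}" using card_free_unbounded by blast
      have "(2::nat) ^ k \<le> 2 ^ card {i. i < b \<and> F i}" using b by (intro power_increasing) auto
      also have "\<dots> \<le> P b" unfolding P_def using M2 by (intro power_mono) auto
      finally have "(2::real) ^ k \<le> real (P b)" by (simp flip: of_nat_le_iff)
      then have "1 / real (P b) \<le> (1/2) ^ k" by (simp add: power_divide frac_le)
      then show False using le[of b] k by simp
    qed
    then obtain b' where b': "a b' y \<noteq> a b' y'" "\<And>i. i < b' \<Longrightarrow> a i y = a i y'"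
      using exists_least_iff[of "\<lambda>b. a b y \<noteq> a b y'"] by auto
    have "a 0 z = 0" if "z \<in> {0..<1}" for z using that by (simp add: a_def P_def floor_eq_iff)
    then have "b' \<noteq> 0" using b' y by metis
    then obtain b where b: "b' = Suc b" using not0_implies_Suc by blast
    have eq: "a b y = a b y'" using b b' by simp
    have "F b"
    proof (rule ccontr)
      assume "\<not> F b"
      then have "a (Suc b) = a b" by (simp add: a_def P_Suc)
      then show False using b'(1) eq b by simp
    qed
    moreover have "a (Suc b) y mod M \<noteq> a (Suc b) y' mod M"
      using b'(1) a_div[OF \<open>F b\<close>] eq y unfolding b by (metis atLeastLessThan_iff div_mult_mod_eq)
    then have "u y b \<noteq> u y' b"
      unfolding u_def using wd M2 by (auto simp: bij_betw_def inj_on_def)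
    ultimately show ?thesis using close eq y by auto
  qed
  \<comment> \<open>Chosen so that \<open>p powr (N * s * b) = M powr (\<theta> * b)\<close>. The
    hypothesis on \<open>card W\<close> gives \<theta> below 1, so the density of the free blocks
    makes \<open>P b\<close> at least this large for late \<open>b\<close>.\<close>
  define \<theta> where "\<theta> = real N * s * ln (real p) / ln (real M)"
  have "real N * s * ln (real p) < ln (real M)"
  proof -
    have "ln (real p powr (real N * s)) < ln (real M)"
      using M M2 p by (subst ln_less_cancel_iff) (auto simp: M_def)
    then show ?thesis using p by (simp add: ln_powr)
  qed
  then have "\<theta> < 1" using M2 by (simp add: \<theta>_def)
  then obtain b0 where b0: "\<And>b. b \<ge> b0 \<Longrightarrow> \<theta> * real b \<le> real (card {i. i < b \<and> F i})"
    using F_dense by (auto simp: eventually_sequentially)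
  \<comment> \<open>One constant for both the blocks before \<open>b0\<close> and the additional
    block in \<open>Suc b\<close>.\<close>
  define C where "C = real p powr (real N * s * real (b0 + 1))"
  have "1 / real (P b) \<le> C * (1 / real p ^ (Suc b * N)) powr s" for b
  proof -
    have "real p powr (real N * s * real (b + 1)) \<le> C * real (P b)"
    proof (cases "b \<ge> b0")
      case True
      have "real p powr (real N * s * real b) = exp (\<theta> * real b * ln (real M))"
        using p M2 by (simp add: powr_def \<theta>_def)
      also have "\<dots> = real M powr (\<theta> * real b)" using M2 by (simp add: powr_def)
      also have "\<dots> \<le> real M powr real (card {i. i < b \<and> F i})"
        using M2 b0[OF True] by (intro powr_mono) auto
      also have "\<dots> = real (P b)" using M2 by (simp add: P_def powr_realpow)
      finally have "real p powr (real N * s * real b) \<le> real (P b)" .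
      moreover have "real p powr (real N * s * 1) \<le> C"
        unfolding C_def using p s by (intro powr_mono mult_left_mono) auto
      moreover have "real p powr (real N * s * real (b + 1)) =
          real p powr (real N * s * 1) * real p powr (real N * s * real b)"
        by (simp add: algebra_simps flip: powr_add)
      ultimately show ?thesis using mult_mono[of "real p powr (real N * s * 1)" C] by (simp add: C_def)
    next
      case False
      have "real p powr (real N * s * real (b + 1)) \<le> C * 1"
        unfolding C_def mult_1_right using p s False by (intro powr_mono mult_left_mono) auto
      also have "\<dots> \<le> C * real (P b)"
        using P_pos[of b] by (intro mult_left_mono) (auto simp: C_def)
      finally show ?thesis .
    qed
    then have "1 / real (P b) \<le> C * (1 / real p powr (real N * s * real (b + 1)))"
      using P_pos[of b] p by (simp add: divide_le_eq le_divide_eq mult.commute)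
    moreover have "(1 / real p ^ (Suc b * N)) powr s = 1 / real p powr (real N * s * real (b + 1))"
      using p by (simp add: powr_divide powr_powr algebra_simps flip: powr_realpow)
    ultimately show ?thesis by (simp only:)
  qed
  note bound = this
  show ?thesis
  proof (rule hausdorff_measure_neq_0I[of "\<lambda>y. point (u y)" _ C])
    show "point (u y) \<in> moving_mean_level_set p \<alpha> \<beta>" for y by (rule point_in_level_set) (rule uW)
    show "0 < C" using p by (simp add: C_def)
    fix y y' :: real assume y: "y \<in> {0..<1}" "y' \<in> {0..<1}"
    show "\<bar>y - y'\<bar> \<le> C * dist (point (u y)) (point (u y')) powr s"
    proof (cases "y = y'")
      case False
      obtain b where b: "F b" "u y b \<noteq> u y' b" "\<bar>y - y'\<bar> \<le> 1 / real (P b)"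
        using split[OF y False] by blast
      have "(1 / real p ^ (Suc b * N)) powr s \<le> dist (point (u y)) (point (u y')) powr s"
        using point_separation[of "u y" "u y'" b, OF uW uW b(1,2)] s by (intro powr_mono2) auto
      then have "C * (1 / real p ^ (Suc b * N)) powr s \<le> C * dist (point (u y)) (point (u y')) powr s"
        by (intro mult_left_mono) (simp_all add: C_def)
      then show ?thesis using b(3) bound[of b] by linarith
    qed (simp add: C_def)
  qed (rule s)
qed

end

section \<open>Choice of the parameters and the lower bound for the dimension\<close>

lemma word_count_greater_powr:
  assumes p: "p \<ge> 2" and s: "ereal s < entropy_fun p t" and "0 \<le> s" "0 < \<delta>"
  shows "\<exists>n\<ge>n0. real p powr (real n * s) < real (word_count p t n \<delta>)"
proof (rule ccontr)
  assume "\<not> ?thesis"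
  then have le: "real (word_count p t n \<delta>) \<le> real p powr (real n * s)" if "n \<ge> n0" for n
    using that by (auto simp: not_less)
  have lp: "0 < ln (real p)" using p by simp
  \<comment> \<open>A bound for all late \<open>n\<close> bounds the limsup. An empty count has
    quotient 0 because \<open>ln 0 = 0\<close>, and there \<open>0 \<le> s\<close> is used.\<close>
  have "entropy_at_scale p t \<delta> \<le> ereal s"
    unfolding entropy_at_scale_def
  proof (rule Limsup_bounded, unfold eventually_sequentially, intro exI[of _ "max 1 n0"] allI impI)
    fix n assume n: "max 1 n0 \<le> n"
    show "ereal (ln (real (word_count p t n \<delta>)) / (real n * ln (real p))) \<le> ereal s"
    proof (cases "word_count p t n \<delta> = 0")
      case False
      then have "ln (real (word_count p t n \<delta>)) \<le> ln (real p powr (real n * s))"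
        using le[of n] n by (intro ln_mono) auto
      then have "ln (real (word_count p t n \<delta>)) / (real n * ln (real p)) \<le> s"
        using n lp p by (simp add: ln_powr field_simps)
      then show ?thesis by simp
    qed (use \<open>0 \<le> s\<close> in simp)
  qed
  moreover have "entropy_fun p t \<le> entropy_at_scale p t \<delta>"
    unfolding entropy_fun_eq_INF[OF p] using \<open>0 < \<delta>\<close> by (intro INF_lower) auto
  ultimately show False using s by simp
qed

text \<open>More than \<open>p powr (n * s1)\<close> words are available, and the surplus exponent
  \<open>n * (s1 - s) = 2 * n * \<eta>\<close> pays for the \<open>2 + c\<close> additional
  positions of a block: one half for the part of \<open>c\<close> proportional to \<open>n\<close>,
  the other for the rest.\<close>

lemma hausdorff_measure_level_set_pos:
  assumes p: "p \<ge> 2" and ab: "0 \<le> \<alpha>" "\<alpha> \<le> t" "t \<le> \<beta>" "\<beta> \<le> real p - 1"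
    and t: "0 < t" "t < real p - 1" and s: "0 \<le> s" "ereal s < entropy_fun p t"
  shows "hausdorff_measure s (moving_mean_level_set p \<alpha> \<beta>) \<noteq> 0"
proof -
  obtain s1 where s1: "s < s1" "ereal s1 < entropy_fun p t"
    using ereal_dense2[OF s(2)] by auto
  \<comment> \<open>The distance from \<open>t\<close> to the nearer extreme digit, which is the
    guaranteed speed of correction in free blocks.\<close>
  define \<mu> where "\<mu> = min t (real p - 1 - t)"
  have \<mu>: "0 < \<mu>" "\<mu> \<le> t" "t \<le> real p - 1 - \<mu>" using t by (auto simp: \<mu>_def)
  define \<eta> where "\<eta> = (s1 - s) / 2"
  \<comment> \<open>About \<open>n * \<delta> / \<mu>\<close> corrections compensate a word, at a
    cost of \<open>n * (\<delta> / \<mu>) * s \<le> n * \<eta>\<close> in the exponent. The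
    denominator \<open>s + 1\<close> admits \<open>s = 0\<close>.\<close>
  define \<delta> where "\<delta> = \<mu> * \<eta> / (s + 1)"
  have \<eta>: "0 < \<eta>" using s1 by (simp add: \<eta>_def)
  have \<delta>: "0 < \<delta>" using \<mu> \<eta> s by (simp add: \<delta>_def)
  \<comment> \<open>Bounds the part of \<open>2 + c\<close> that does not grow with
    \<open>n\<close>: 2 for the suffix, 1 for rounding, and the quotient for the deviation due to
    the suffix. Then \<open>n0\<close> ensures \<open>K * s \<le> n * \<eta>\<close>.\<close>
  define K where "K = 3 + (1 + 2 * real p) / \<mu>"
  define n0 where "n0 = nat \<lceil>K * s / \<eta>\<rceil> + 1"
  obtain n where n: "n \<ge> n0" "real p powr (real n * s1) < real (word_count p t n \<delta>)"
    using word_count_greater_powr[OF p s1(2) _ \<delta>] s s1 by auto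
  \<comment> \<open>The least number of corrections with
    \<open>c * \<mu> \<ge> n * \<delta> + 1 + 2 * p\<close>. The last two terms account for the
    suffix \<open>[1, 0]\<close>, whose sum 1 is compared with \<open>2 * t\<close>.\<close>
  define c where "c = nat \<lceil>(real n * \<delta> + 1 + 2 * real p) / \<mu>\<rceil>"
  have "0 \<le> (real n * \<delta> + 1 + 2 * real p) / \<mu>" using \<delta> \<mu> by simp
  then have c: "(real n * \<delta> + 1 + 2 * real p) / \<mu> \<le> real c"
    "real c \<le> (real n * \<delta> + 1 + 2 * real p) / \<mu> + 1"
    unfolding c_def by linarith+
  define V where "V = {w \<in> words p n. real n * (t - \<delta>) < real (sum_list w) \<and> real (sum_list w) < real n * (t + \<delta>)}"
  define W where "W = (\<lambda>w. w @ [1, 0]) ` V"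
  have "card W = word_count p t n \<delta>"
    unfolding W_def word_count_eq V_def by (intro card_image) (auto simp: inj_on_def)
  moreover have "real p powr (real (n + 2 + c) * s) \<le> real p powr (real n * s1)"
  proof (rule powr_mono)
    have "K * s / \<eta> \<le> real n" using n(1) unfolding n0_def by linarith
    then have K: "K * s \<le> real n * \<eta>" using \<eta> by (simp add: field_simps)
    have "\<delta> / \<mu> * s = \<eta> * (s / (s + 1))" using \<mu> s by (simp add: \<delta>_def)
    also have "\<dots> \<le> \<eta> * 1" using s \<eta> by (intro mult_left_mono) (auto simp: field_simps)
    finally have d: "real n * (\<delta> / \<mu> * s) \<le> real n * \<eta>" by (intro mult_left_mono) auto
    have "real (n + 2 + c) \<le> real n + real n * (\<delta> / \<mu>) + K"
      using c(2) by (simp add: K_def add_divide_distrib)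
    then have "real (n + 2 + c) * s \<le> (real n + real n * (\<delta> / \<mu>) + K) * s"
      using s by (intro mult_right_mono)
    also have "\<dots> = real n * s + real n * (\<delta> / \<mu> * s) + K * s" by (simp add: algebra_simps)
    also have "\<dots> \<le> real n * s + real n * \<eta> + real n * \<eta>" using d K by linarith
    also have "\<dots> = real n * s1" by (simp add: \<eta>_def field_simps)
    finally show "real (n + 2 + c) * s \<le> real n * s1" .
  qed (use p in simp)
  ultimately have card: "real p powr (real (n + 2 + c) * s) < real (card W)" using n(2) by simp
  obtain \<tau> F where \<tau>: "\<And>b. \<alpha> \<le> \<tau> b" "\<And>b. \<tau> b \<le> \<beta>" "\<And>b. F b \<Longrightarrow> \<tau> b = t"
    "\<And>L m. \<exists>b\<ge>m. \<forall>i<L. \<tau> (b + i) = \<alpha>" "\<And>L m. \<exists>b\<ge>m. \<forall>i<L. \<tau> (b + i) = \<beta>"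
    "\<And>\<theta>::real. \<theta> < 1 \<Longrightarrow> \<forall>\<^sub>F b in sequentially. \<theta> * real b \<le> real (card {i. i < b \<and> F i})"
    by (fact target_schedule_exists[OF ab(2,3)])
  interpret block_scheme p "n + 2" c W \<tau> F \<alpha> \<beta> t \<mu>
  proof
    show "W \<subseteq> words p (n + 2)" using p by (force simp: W_def V_def words_def)
    show "\<bar>real (sum_list w) - real (n + 2) * t\<bar> \<le> real c * \<mu>" if "w \<in> W" for w
    proof -
      obtain v where v: "w = v @ [1, 0]" "real n * (t - \<delta>) < real (sum_list v)"
        "real (sum_list v) < real n * (t + \<delta>)"
        using \<open>w \<in> W\<close> by (auto simp: W_def V_def)
      have "real n * \<delta> + 1 + 2 * real p \<le> real c * \<mu>" using c(1) \<mu> by (simp add: field_simps)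
      then show ?thesis using v t by (simp add: abs_le_iff algebra_simps)
    qed
    show "w ! (n + 2 - 2) = 1" "w ! (n + 2 - 1) = 0" if "w \<in> W" for w
      using that by (auto simp: W_def V_def words_def nth_append)
    show "\<tau> b = t" if "F b" for b using that by (rule \<tau>)
  qed (rule \<tau> p ab \<mu> | use \<mu> in \<open>simp; fail\<close> | assumption)+
  show ?thesis using hausdorff_measure_level_set_neq_0[OF s(1)] card unfolding N_def by simp
qed

theorem theorem1p2:
  fixes p :: nat and \<alpha> \<beta> :: real
  assumes "p \<ge> 2" and "0 \<le> \<alpha>" and "\<alpha> \<le> \<beta>" and "\<beta> \<le> real p - 1"
  shows "hausdorff_dim (moving_mean_level_set p \<alpha> \<beta>) = (SUP t \<in> {\<alpha>..\<beta>}. entropy_fun p t)"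
proof (rule antisym)
  show "hausdorff_dim (moving_mean_level_set p \<alpha> \<beta>) \<le> (SUP t \<in> {\<alpha>..\<beta>}. entropy_fun p t)"
    using assms by (intro hausdorff_dim_level_set_le)
  show "(SUP t \<in> {\<alpha>..\<beta>}. entropy_fun p t) \<le> hausdorff_dim (moving_mean_level_set p \<alpha> \<beta>)"
  proof (rule SUP_least)
    fix t assume t: "t \<in> {\<alpha>..\<beta>}"
    show "entropy_fun p t \<le> hausdorff_dim (moving_mean_level_set p \<alpha> \<beta>)"
    proof (cases "t = 0 \<or> t = real p - 1")
      case True
      \<comment> \<open>At an extreme digit the speed of correction would be 0, so the construction
        is replaced by the trivial bound: the entropy vanishes and dimensions are
        nonnegative.\<close>
      then have "entropy_fun p t \<le> 0"
        using entropy_fun_0_le entropy_fun_max_le assms(1) by auto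
      then show ?thesis using hausdorff_dim_nonneg order_trans by blast
    next
      case False
      then have "0 < t" "t < real p - 1" using t assms by auto
      then show ?thesis
        using t assms by (intro le_hausdorff_dimI hausdorff_measure_level_set_pos) auto
    qed
  qed
qed

end
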